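(* Let $G$ be a finite connected loopless graph, let $r=|V(G)|-1$, fix any total ordering of $E(G)$ and any field $\Bbbk$, and let $h_G(z)=\sum_{i=0}^{r}h_i z^i$ be the $h$-polynomial of the broken-circuit complex $\mathrm{BC}(G)$. Let $f(G;t,x,y)$ be the Negami polynomial of $G$. Then $$h_G(z)=(-z)^r\left[\frac{f(G;q,-1,1)}{q}\right]_{q=(z-1)/z},$$ and consequently the Hilbert series of the Stanley--Reisner ring $\Bbbk[\mathrm{BC}(G)]$ is $$\mathrm{Hilb}(\Bbbk[\mathrm{BC}(G)];z)=\frac{h_G(z)}{(1-z)^r}.$$
   Context: Graphs are finite; multiple edges are allowed. The Negami polynomial $f(G)=f(G;t,x,y)$ of a finite graph is the polynomial determined by $f(\overline K_n)=t^n$, where $\overline K_n$ is the edgeless graph on $n$ vertices, and $f(G)=x f(G/e)+y f(G-e)$ for any edge $e$, where $G/e$ and $G-e$ are the contraction and deletion of $e$ (contraction keeps any resulting loops and multiple edges; contracting a loop means deleting it). Let $G$ be connected and loopless with a fixed total order on $E(G)$. A broken circuit is a set $C\setminus\{\max C\}$, where $C$ is the edge set of a cycle of $G$ and $\max C$ is its largest edge. The broken-circuit complex $\mathrm{BC}(G)$ is the simplicial complex on $E(G)$ whose faces are the edge sets containing no broken circuit. Its Stanley--Reisner ring is $\Bbbk[\mathrm{BC}(G)]=\Bbbk[x_e:e\in E(G)]/I_{\mathrm{BC}(G)}$, with $I_{\mathrm{BC}(G)}$ generated by the monomials $\prod_{e\in C\setminus\{\max C\}}x_e$ over all cycles $C$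 of $G$; it is graded by $\deg x_e=1$. With $r=|V(G)|-1$ and $b_i$ the number of faces of $\mathrm{BC}(G)$ having exactly $i$ elements, the $h$-polynomial is $h_G(z)=\sum_{i=0}^{r}b_i z^i(1-z)^{r-i}$. The first formula is an identity of rational functions in $z$. *)

theory Defs
  imports
    "HOL-Algebra.Embedded_Algebras"
    "HOL-Algebra.QuotRing"
    "HOL-Library.Poly_Mapping"
    "HOL-Computational_Algebra.Computational_Algebra"
begin

section \<open>Finite multigraphs\<close>

text \<open>An edge is a name together with its set of endpoints: one endpoint for a loop, two
  otherwise. Parallel edges are distinct names with the same set of endpoints.\<close>

record ('v, 'e) mgraph =
  verts :: "'v set"
  edges :: "'e set"
  ends :: "'e \<Rightarrow> 'v set"

definition multigraph :: "('v, 'e) mgraph \<Rightarrow> bool" where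
  "multigraph G \<longleftrightarrow> finite (verts G) \<and> finite (edges G) \<and>
     (\<forall>e\<in>edges G. ends G e \<subseteq> verts G \<and> card (ends G e) \<in> {1, 2})"

definition loopless :: "('v, 'e) mgraph \<Rightarrow> bool" where
  "loopless G \<longleftrightarrow> (\<forall>e\<in>edges G. card (ends G e) \<noteq> 1)"

definition adjacent_via :: "('v, 'e) mgraph \<Rightarrow> 'e set \<Rightarrow> 'v rel" where
  "adjacent_via G A = {(u, v). \<exists>e\<in>A. ends G e = {u, v}}"

definition connected_graph :: "('v, 'e) mgraph \<Rightarrow> bool" where
  "connected_graph G \<longleftrightarrow> verts G \<noteq> {} \<and>
     (\<forall>u\<in>verts G. \<forall>v\<in>verts G. (u, v) \<in> (adjacent_via G (edges G))\<^sup>*)"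

definition delete_edge :: "('v, 'e) mgraph \<Rightarrow> 'e \<Rightarrow> ('v, 'e) mgraph" where
  "delete_edge G e = G\<lparr>edges := edges G - {e}\<rparr>"

text \<open>Contraction identifies the endpoints of the edge with one chosen endpoint. Contracting a
  loop moves no vertex, hence merely deletes the loop.\<close>

definition contraction_map :: "('v, 'e) mgraph \<Rightarrow> 'e \<Rightarrow> 'v \<Rightarrow> 'v" where
  "contraction_map G e v = (if v \<in> ends G e then (SOME u. u \<in> ends G e) else v)"

definition contract_edge :: "('v, 'e) mgraph \<Rightarrow> 'e \<Rightarrow> ('v, 'e) mgraph" where
  "contract_edge G e =
     \<lparr>verts = contraction_map G e ` verts G,
      edges = edges G - {e},
      ends = (\<lambda>f. contraction_map G e ` ends G f)\<rparr>"

section \<open>The Negami polynomial\<close>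

text \<open>Polynomials in \<open>t, x, y\<close> are elements of \<open>\<int>[y][x][t]\<close>, i.e. \<open>t\<close> is the outermost variable.\<close>

definition var_t :: "int poly poly poly" where "var_t = [:0, 1:]"
definition var_x :: "int poly poly poly" where "var_x = [:[:0, 1:]:]"
definition var_y :: "int poly poly poly" where "var_y = [:[:[:0, 1:]:]:]"

definition eval_txy :: "int poly poly poly \<Rightarrow> 'a::comm_ring_1 \<Rightarrow> 'a \<Rightarrow> 'a \<Rightarrow> 'a" where
  "eval_txy p t x y =
     poly (map_poly (\<lambda>p'. poly (map_poly (\<lambda>p''. poly (map_poly of_int p'') y) p') x) p) t"

definition negami_recursion :: "(('v, 'e) mgraph \<Rightarrow> int poly poly poly) \<Rightarrow> bool" where
  "negami_recursion f \<longleftrightarrow>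
     (\<forall>G. multigraph G \<longrightarrow>
       (edges G = {} \<longrightarrow> f G = var_t ^ card (verts G)) \<and>
       (\<forall>e\<in>edges G. f G = var_x * f (contract_edge G e) + var_y * f (delete_edge G e)))"

text \<open>The choice is only over values at records that are not multigraphs: see
  \<open>negami_polynomial_unique\<close> below.\<close>

definition negami_polynomial :: "('v, 'e) mgraph \<Rightarrow> int poly poly poly" where
  "negami_polynomial = (SOME f. negami_recursion f)"

subsection \<open>Existence and uniqueness\<close>

lemma multigraph_delete_edge: "multigraph G \<Longrightarrow> multigraph (delete_edge G e)"
  by (auto simp: multigraph_def delete_edge_def)

lemma multigraph_contract_edge:
  assumes "multigraph G"
  shows "multigraph (contract_edge G e)"
proof -
  have "card (contraction_map G e ` ends G f) \<in> {1, 2}" if "f \<in> edges G" for f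
  proof -
    have *: "card (ends G f) \<in> {1, 2}" using assms that by (auto simp: multigraph_def)
    hence fin: "finite (ends G f)" "ends G f \<noteq> {}" by (auto intro: card_ge_0_finite)
    have "card (contraction_map G e ` ends G f) \<le> card (ends G f)"
      using fin by (intro card_image_le)
    moreover have "card (contraction_map G e ` ends G f) \<noteq> 0" using fin by simp
    ultimately show ?thesis using * by auto
  qed
  thus ?thesis using assms by (auto simp: multigraph_def contract_edge_def)
qed

lemma sym_adjacent_via: "sym (adjacent_via G A)"
  by (auto simp: sym_def adjacent_via_def insert_commute)

lemma adjacent_via_rtrancl_sym:
  "(u, v) \<in> (adjacent_via G A)\<^sup>* \<Longrightarrow> (v, u) \<in> (adjacent_via G A)\<^sup>*"
  by (metis sym_adjacent_via sym_rtrancl symD)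

text \<open>Number of connected components of the spanning subgraph with edge set \<open>A\<close>.\<close>

definition num_components :: "('v, 'e) mgraph \<Rightarrow> 'e set \<Rightarrow> nat" where
  "num_components G A = card ((\<lambda>v. (adjacent_via G A)\<^sup>* `` {v}) ` verts G)"

lemma component_eq_iff:
  "(adjacent_via G A)\<^sup>* `` {u} = (adjacent_via G A)\<^sup>* `` {v} \<longleftrightarrow> (u, v) \<in> (adjacent_via G A)\<^sup>*"
  (is "?l \<longleftrightarrow> ?r")
proof
  assume ?l
  thus ?r by (metis ImageI Image_singleton_iff rtrancl.rtrancl_refl)
next
  assume r: ?r
  note r' = adjacent_via_rtrancl_sym[OF r]
  show ?l using r r' by (auto intro: rtrancl_trans)
qed

lemma card_image_eq_if_same_fibres:
  assumes "\<And>u v. u \<in> V \<Longrightarrow> v \<in> V \<Longrightarrow> g u = g v \<longleftrightarrow> h u = h v"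
  shows "card (g ` V) = card (h ` V)"
proof (rule bij_betw_same_card)
  let ?k = "\<lambda>c. h (SOME v. v \<in> V \<and> g v = c)"
  have k: "?k (g v) = h v" if "v \<in> V" for v
  proof -
    have "(SOME w. w \<in> V \<and> g w = g v) \<in> V \<and> g (SOME w. w \<in> V \<and> g w = g v) = g v"
      by (rule someI[of _ v]) (use that in auto)
    thus ?thesis using assms that by blast
  qed
  show "bij_betw ?k (g ` V) (h ` V)"
    unfolding bij_betw_def
  proof
    show "inj_on ?k (g ` V)" using k assms by (force simp: inj_on_def)
    show "?k ` g ` V = h ` V" using k by (force simp: image_iff)
  qed
qed

lemma num_components_contract:
  assumes G: "multigraph G" and e: "e \<in> edges G" and A: "A \<subseteq> edges G"
  shows "num_components (contract_edge G e) A = num_components G (insert e A)"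
proof -
  define \<pi> where "\<pi> = contraction_map G e"
  let ?S = "(adjacent_via G (insert e A))\<^sup>*" and ?T = "(adjacent_via (contract_edge G e) A)\<^sup>*"
  have card_e: "card (ends G e) = 1 \<or> card (ends G e) = 2"
    using G e by (auto simp: multigraph_def)
  hence ne: "ends G e \<noteq> {}" by auto
  have conn_e: "(u, v) \<in> ?S" if "u \<in> ends G e" "v \<in> ends G e" for u v
  proof (cases "u = v")
    case False
    then obtain a b where "ends G e = {a, b}" using card_e that
      by (auto simp: card_1_singleton_iff card_2_iff)
    hence "ends G e = {u, v}" using that False by auto
    thus ?thesis by (auto simp: adjacent_via_def)
  qed auto
  have some: "(SOME u. u \<in> ends G e) \<in> ends G e" using ne by (simp add: some_in_eq)
  have conn_pi: "(v, \<pi> v) \<in> ?S" for v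
    using conn_e some by (auto simp: \<pi>_def contraction_map_def)
  have pi_e: "\<pi> u = \<pi> v" if "u \<in> ends G e" "v \<in> ends G e" for u v
    using that by (simp add: \<pi>_def contraction_map_def)
  have 1: "(\<pi> u, \<pi> v) \<in> ?T" if "(u, v) \<in> ?S" for u v
    using that
  proof (induction rule: rtrancl_induct)
    case (step b c)
    then obtain f where f: "f = e \<or> f \<in> A" "ends G f = {b, c}" by (auto simp: adjacent_via_def)
    show ?case
    proof (cases "f = e")
      case True
      thus ?thesis using pi_e[of b c] f step by auto
    next
      case False
      hence "(\<pi> b, \<pi> c) \<in> adjacent_via (contract_edge G e) A"
        using f by (auto simp: adjacent_via_def contract_edge_def \<pi>_def intro!: bexI[of _ f])
      thus ?thesis using step by auto
    qed
  qed auto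
  have edge_conn: "(a, b) \<in> ?S" if f: "f \<in> A" and ab: "a \<in> ends G f" "b \<in> ends G f" for a b f
  proof (cases "a = b")
    case False
    have "card (ends G f) = 1 \<or> card (ends G f) = 2"
      using G A f by (auto simp: multigraph_def)
    hence "ends G f = {a, b}" using ab False
      by (auto simp: card_1_singleton_iff card_2_iff)
    thus ?thesis using f by (auto simp: adjacent_via_def)
  qed auto
  have 2: "(a, b) \<in> ?S" if "(a, b) \<in> ?T" for a b
    using that
  proof (induction rule: rtrancl_induct)
    case (step b c)
    then obtain f where f: "f \<in> A" "\<pi> ` ends G f = {b, c}"
      by (auto simp: adjacent_via_def contract_edge_def \<pi>_def)
    have "b \<in> \<pi> ` ends G f" "c \<in> \<pi> ` ends G f" using f by auto
    then obtain b' c' where bc: "b' \<in> ends G f" "c' \<in> ends G f" "b = \<pi> b'" "c = \<pi> c'" by blast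
    have "(b, b') \<in> ?S" using conn_pi adjacent_via_rtrancl_sym bc by metis
    moreover have "(b', c') \<in> ?S" using edge_conn[OF f(1)] bc by auto
    moreover have "(c', c) \<in> ?S" using conn_pi bc by metis
    ultimately show ?case using step.IH by (meson rtrancl_trans)
  qed auto
  have eq: "(u, v) \<in> ?S \<longleftrightarrow> (\<pi> u, \<pi> v) \<in> ?T" for u v
  proof
    assume "(\<pi> u, \<pi> v) \<in> ?T"
    hence "(\<pi> u, \<pi> v) \<in> ?S" by (rule 2)
    thus "(u, v) \<in> ?S" using conn_pi adjacent_via_rtrancl_sym by (meson rtrancl_trans)
  qed (rule 1)
  have "num_components (contract_edge G e) A = card ((\<lambda>v. ?T `` {\<pi> v}) ` verts G)"
    by (simp add: num_components_def contract_edge_def \<pi>_def image_image)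
  also have "\<dots> = card ((\<lambda>v. ?S `` {v}) ` verts G)"
    by (rule card_image_eq_if_same_fibres) (simp only: component_eq_iff eq)
  finally show ?thesis by (simp add: num_components_def)
qed

definition negami_expansion :: "('v, 'e) mgraph \<Rightarrow> int poly poly poly" where
  "negami_expansion G =
     (\<Sum>A\<in>Pow (edges G). var_t ^ num_components G A * var_x ^ card A * var_y ^ card (edges G - A))"

lemma negami_recursion_expansion: "negami_recursion negami_expansion"
  unfolding negami_recursion_def
proof (intro allI impI conjI ballI)
  fix G :: "('a, 'b) mgraph"
  assume "multigraph G" "edges G = {}"
  moreover have "num_components G {} = card (verts G)"
    unfolding num_components_def by (rule card_image) (auto simp: inj_on_def adjacent_via_def)
  ultimately show "negami_expansion G = var_t ^ card (verts G)"
    by (simp add: negami_expansion_def)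
next
  fix G :: "('a, 'b) mgraph" and e
  assume G: "multigraph G" and e: "e \<in> edges G"
  define E where "E = edges G - {e}"
  have fin: "finite E" "e \<notin> E" and E: "edges G = insert e E"
    using G e by (auto simp: E_def multigraph_def)
  let ?t = "\<lambda>A. var_t ^ num_components G A * var_x ^ card A * var_y ^ card (edges G - A)"
  have disj: "Pow E \<inter> insert e ` Pow E = {}" using fin by auto
  have inj: "inj_on (insert e) (Pow E)" using fin by (auto simp: inj_on_def)
  have "negami_expansion G = sum ?t (Pow E) + sum ?t (insert e ` Pow E)"
    unfolding negami_expansion_def E Pow_insert using fin disj
    by (subst sum.union_disjoint) auto
  also have "sum ?t (insert e ` Pow E) = (\<Sum>A\<in>Pow E. ?t (insert e A))"
    using inj by (simp add: sum.reindex)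
  also have "\<dots> = var_x * negami_expansion (contract_edge G e)"
    unfolding negami_expansion_def sum_distrib_left
  proof (rule sum.cong)
    fix A assume "A \<in> Pow (edges (contract_edge G e))"
    hence A: "A \<in> Pow E" by (simp add: contract_edge_def E_def)
    have "card (insert e A) = Suc (card A)" using A fin by (auto intro: card_insert_disjoint finite_subset)
    moreover have "edges G - insert e A = edges (contract_edge G e) - A"
      using A fin E by (auto simp: contract_edge_def)
    ultimately show "?t (insert e A) = var_x * (var_t ^ num_components (contract_edge G e) A *
        var_x ^ card A * var_y ^ card (edges (contract_edge G e) - A))"
      using num_components_contract[OF G e, of A, symmetric] subset_insertI2[of A E e] A
      unfolding E by (simp add: algebra_simps)
  qed (simp add: contract_edge_def E_def)
  also have "sum ?t (Pow E) = var_y * negami_expansion (delete_edge G e)"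
    unfolding negami_expansion_def sum_distrib_left
  proof (rule sum.cong)
    fix A assume "A \<in> Pow (edges (delete_edge G e))"
    hence A: "A \<in> Pow E" by (simp add: delete_edge_def E_def)
    have "edges G - A = insert e (E - A)" using A fin E by auto
    hence "card (edges G - A) = Suc (card (edges (delete_edge G e) - A))"
      using A fin by (simp add: delete_edge_def E_def)
    moreover have "num_components (delete_edge G e) A = num_components G A"
      by (simp add: num_components_def adjacent_via_def delete_edge_def)
    ultimately show "?t A = var_y * (var_t ^ num_components (delete_edge G e) A *
        var_x ^ card A * var_y ^ card (edges (delete_edge G e) - A))"
      by (simp add: algebra_simps)
  qed (simp add: delete_edge_def E_def)
  finally show "negami_expansion G =
      var_x * negami_expansion (contract_edge G e) + var_y * negami_expansion (delete_edge G e)"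
    by (simp add: add.commute)
qed

lemma negami_polynomial_recursion: "negami_recursion negami_polynomial"
  unfolding negami_polynomial_def
  by (rule someI[of negami_recursion, OF negami_recursion_expansion])

lemma negami_recursion_unique:
  assumes "negami_recursion f" "negami_recursion g" "multigraph G"
  shows "f G = g G"
  using assms(3)
proof (induction "card (edges G)" arbitrary: G rule: less_induct)
  case less
  show ?case
  proof (cases "edges G = {}")
    case True
    thus ?thesis using assms(1,2) less.prems by (simp add: negami_recursion_def)
  next
    case False
    then obtain e where e: "e \<in> edges G" by auto
    have "card (edges G - {e}) < card (edges G)"
      using e less.prems by (intro card_Diff1_less) (auto simp: multigraph_def)
    hence "f (contract_edge G e) = g (contract_edge G e)"
      and "f (delete_edge G e) = g (delete_edge G e)"
      using less.hyps multigraph_delete_edge[OF less.prems] multigraph_contract_edge[OF less.prems]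
      by (auto simp: contract_edge_def delete_edge_def)
    thus ?thesis using assms(1,2) less.prems e by (auto simp: negami_recursion_def)
  qed
qed

lemma negami_polynomial_unique:
  "negami_recursion f \<Longrightarrow> multigraph G \<Longrightarrow> f G = negami_polynomial G"
  by (rule negami_recursion_unique[OF _ negami_polynomial_recursion])

section \<open>The broken-circuit complex\<close>

text \<open>The \<open>i\<close>-th edge of a cycle joins the \<open>i\<close>-th vertex to the next one, cyclically. Length 1 is
  a loop and length 2 a pair of parallel edges.\<close>

definition cycle_edge_set :: "('v, 'e) mgraph \<Rightarrow> 'e set \<Rightarrow> bool" where
  "cycle_edge_set G C \<longleftrightarrow>
     (\<exists>vs es. es \<noteq> [] \<and> length vs = length es \<and> distinct vs \<and> distinct es \<and>
        set es \<subseteq> edges G \<and>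
        (\<forall>i<length es. ends G (es ! i) = {vs ! i, vs ! (Suc i mod length es)}) \<and>
        C = set es)"

text \<open>In the order relation \<open>L\<close>, \<open>(a, b) \<in> L\<close> means that \<open>a\<close> is at most \<open>b\<close>.\<close>

definition broken_circuit :: "('v, 'e) mgraph \<Rightarrow> 'e rel \<Rightarrow> 'e set \<Rightarrow> bool" where
  "broken_circuit G L B \<longleftrightarrow>
     (\<exists>C m. cycle_edge_set G C \<and> m \<in> C \<and> (\<forall>c\<in>C. (c, m) \<in> L) \<and> B = C - {m})"

definition bc_complex :: "('v, 'e) mgraph \<Rightarrow> 'e rel \<Rightarrow> 'e set set" where
  "bc_complex G L = {A. A \<subseteq> edges G \<and> \<not> (\<exists>B. broken_circuit G L B \<and> B \<subseteq> A)}"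

definition graph_rank :: "('v, 'e) mgraph \<Rightarrow> nat" where
  "graph_rank G = card (verts G) - 1"

definition h_polynomial :: "('v, 'e) mgraph \<Rightarrow> 'e rel \<Rightarrow> rat poly" where
  "h_polynomial G L =
     (\<Sum>i\<le>graph_rank G. of_nat (card {A \<in> bc_complex G L. card A = i}) *
        [:0, 1:] ^ i * (1 - [:0, 1:]) ^ (graph_rank G - i))"

section \<open>The Stanley--Reisner ring and its Hilbert series\<close>

text \<open>The ring \<open>k[x\<^sub>e : e \<in> E]\<close>, as a subring of the polynomials over all variables in \<open>'e\<close>: a
  polynomial is a finitely supported function on exponent vectors.\<close>

definition polynomial_ring :: "'e set \<Rightarrow> (('e \<Rightarrow>\<^sub>0 nat) \<Rightarrow>\<^sub>0 'k::field) ring" where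
  "polynomial_ring E =
     \<lparr>carrier = {p. \<forall>m\<in>Poly_Mapping.keys p. Poly_Mapping.keys m \<subseteq> E},
      monoid.mult = (*), one = 1, zero = 0, add = (+)\<rparr>"

definition variable :: "'e \<Rightarrow> ('e \<Rightarrow>\<^sub>0 nat) \<Rightarrow>\<^sub>0 'k::field" where
  "variable e = Poly_Mapping.single (Poly_Mapping.single e 1) 1"

definition const_poly :: "'k \<Rightarrow> ('e \<Rightarrow>\<^sub>0 nat) \<Rightarrow>\<^sub>0 'k::field" where
  "const_poly c = Poly_Mapping.single 0 c"

definition homogeneous :: "nat \<Rightarrow> (('e \<Rightarrow>\<^sub>0 nat) \<Rightarrow>\<^sub>0 'k::field) \<Rightarrow> bool" where
  "homogeneous d p \<longleftrightarrow>
     (\<forall>m\<in>Poly_Mapping.keys p. (\<Sum>e\<in>Poly_Mapping.keys m. Poly_Mapping.lookup m e) = d)"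

definition bc_ideal :: "('v, 'e) mgraph \<Rightarrow> 'e rel \<Rightarrow> (('e \<Rightarrow>\<^sub>0 nat) \<Rightarrow>\<^sub>0 'k::field) set" where
  "bc_ideal G L =
     Idl\<^bsub>polynomial_ring (edges G)\<^esub> {\<Prod>e\<in>B. variable e | B. broken_circuit G L B}"

definition bc_ring :: "('v, 'e) mgraph \<Rightarrow> 'e rel \<Rightarrow> (('e \<Rightarrow>\<^sub>0 nat) \<Rightarrow>\<^sub>0 'k::field) set ring" where
  "bc_ring G L = polynomial_ring (edges G) Quot bc_ideal G L"

definition bc_residue ::
    "('v, 'e) mgraph \<Rightarrow> 'e rel \<Rightarrow> (('e \<Rightarrow>\<^sub>0 nat) \<Rightarrow>\<^sub>0 'k::field) \<Rightarrow> (('e \<Rightarrow>\<^sub>0 nat) \<Rightarrow>\<^sub>0 'k) set" where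
  "bc_residue G L p = bc_ideal G L +>\<^bsub>polynomial_ring (edges G)\<^esub> p"

definition bc_scalars :: "('v, 'e) mgraph \<Rightarrow> 'e rel \<Rightarrow> (('e \<Rightarrow>\<^sub>0 nat) \<Rightarrow>\<^sub>0 'k::field) set set" where
  "bc_scalars G L = range (\<lambda>c. bc_residue G L (const_poly c))"

definition bc_graded_part ::
    "('v, 'e) mgraph \<Rightarrow> 'e rel \<Rightarrow> nat \<Rightarrow> (('e \<Rightarrow>\<^sub>0 nat) \<Rightarrow>\<^sub>0 'k::field) set set" where
  "bc_graded_part G L d =
     bc_residue G L ` {p \<in> carrier (polynomial_ring (edges G)). homogeneous d p}"

text \<open>The type argument selects the coefficient field.\<close>

definition bc_hilbert_series :: "'k::field itself \<Rightarrow> ('v, 'e) mgraph \<Rightarrow> 'e rel \<Rightarrow> rat fps" where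
  "bc_hilbert_series _ G L =
     Abs_fps (\<lambda>d. of_nat (THE n. ring.dimension (bc_ring G L) n
       (bc_scalars G L :: (('e \<Rightarrow>\<^sub>0 nat) \<Rightarrow>\<^sub>0 'k) set set) (bc_graded_part G L d)))"

end

theory Submission
  imports Defs "HOL-Library.Disjoint_Sets" "HOL-Library.Transitive_Closure_Table"
begin

text \<open>The first identity is Whitney's broken-circuit theorem. Expanding the Negami polynomial at
  \<open>x = -1\<close>, \<open>y = 1\<close> gives the sum of \<open>(-1)\<^bsup>|A|\<^esup> q\<^bsup>c(A)\<^esup>\<close> over all edge sets \<open>A\<close>, where \<open>c(A)\<close> counts
  components. If \<open>A\<close> contains a broken circuit with missing edge \<open>e\<close>, then adding or removing \<open>e\<close> changes
  neither the components nor the set of such missing edges, so these terms cancel in pairs. The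
  remaining sets are forests, for which \<open>c(A) = |V| - |A|\<close>.

  The Stanley--Reisner ideal consists of the polynomials all of whose monomials have a non-face as
  support, so the monomials supported on faces form a basis of the quotient. Those with support
  exactly \<open>F\<close> contribute \<open>(z / (1 - z))\<^bsup>|F|\<^esup>\<close> to the Hilbert series.\<close>

section \<open>Broken circuits and components\<close>

text \<open>Membership in the closure of \<open>A\<close> in the cycle matroid. Ranging over all
  pairs of endpoints avoids orienting the edge; a loop is spanned by every set.\<close>

definition spanned :: "('v, 'e) mgraph \<Rightarrow> 'e set \<Rightarrow> 'e \<Rightarrow> bool" where
  "spanned G A e \<longleftrightarrow> (\<forall>u\<in>ends G e. \<forall>v\<in>ends G e. (u, v) \<in> (adjacent_via G A)\<^sup>*)"

lemma adjacent_via_mono: "A \<subseteq> B \<Longrightarrow> adjacent_via G A \<subseteq> adjacent_via G B"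
  by (auto simp: adjacent_via_def)

lemma spanned_mono: "spanned G A e \<Longrightarrow> A \<subseteq> B \<Longrightarrow> spanned G B e"
  unfolding spanned_def using rtrancl_mono[OF adjacent_via_mono] by blast

lemma multigraph_obtain_ends:
  assumes "multigraph G" "e \<in> edges G"
  obtains u v where "ends G e = {u, v}" "u \<in> verts G" "v \<in> verts G"
proof -
  have "card (ends G e) = 1 \<or> card (ends G e) = 2" and *: "ends G e \<subseteq> verts G"
    using assms by (auto simp: multigraph_def)
  hence "\<exists>u v. ends G e = {u, v}" by (auto simp: card_1_singleton_iff card_2_iff)
  thus ?thesis using that * by auto
qed

lemma adjacent_via_insert_spanned:
  assumes "spanned G A e"
  shows "(adjacent_via G (insert e A))\<^sup>* = (adjacent_via G A)\<^sup>*"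
proof (rule rtrancl_subset)
  show "adjacent_via G A \<subseteq> adjacent_via G (insert e A)" by (rule adjacent_via_mono) auto
  show "adjacent_via G (insert e A) \<subseteq> (adjacent_via G A)\<^sup>*"
    using assms by (auto simp: adjacent_via_def spanned_def)
qed

lemma num_components_insert_spanned:
  "spanned G A e \<Longrightarrow> num_components G (insert e A) = num_components G A"
  by (simp add: num_components_def adjacent_via_insert_spanned)

text \<open>The endpoints of \<open>e\<close> lie in two distinct classes, which merge into one;
  every other class survives.\<close>

lemma num_components_insert_not_spanned:
  assumes G: "multigraph G" and e: "e \<in> edges G" and ns: "\<not> spanned G A e"
  shows "num_components G A = Suc (num_components G (insert e A))"
proof -
  let ?R = "(adjacent_via G A)\<^sup>*" and ?S = "(adjacent_via G (insert e A))\<^sup>*"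
  obtain u v where uv: "ends G e = {u, v}" "u \<in> verts G" "v \<in> verts G"
    using multigraph_obtain_ends[OF G e] .
  define U where "U = ?R `` {u} \<union> ?R `` {v}"
  have RS: "?R \<subseteq> ?S" by (intro rtrancl_mono adjacent_via_mono) auto
  have symR: "(b, a) \<in> ?R" if "(a, b) \<in> ?R" for a b
    using that by (rule adjacent_via_rtrancl_sym)
  have uvS: "(u, v) \<in> ?S" using uv by (auto simp: adjacent_via_def)
  hence vuS: "(v, u) \<in> ?S" by (rule adjacent_via_rtrancl_sym)
  have uvR: "(u, v) \<notin> ?R" using ns uv symR by (auto simp: spanned_def)
  have closed: "b \<in> U \<longleftrightarrow> a \<in> U" if "(a, b) \<in> ?R" for a b
    using that symR[OF that] by (auto simp: U_def intro: rtrancl_trans)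
  \<comment> \<open>The only new adjacency, along \<open>e\<close>, stays inside \<open>U\<close>,
    and \<open>U\<close> is a union of classes for \<open>?R\<close>; so the alternative persists
    along a path.\<close>
  have SE: "(a, b) \<in> ?R \<or> (a \<in> U \<and> b \<in> U)" if "(a, b) \<in> ?S" for a b
    using that
  proof (induction rule: rtrancl_induct)
    case (step b c)
    from step.hyps(2) have "(b, c) \<in> ?R \<or> (b \<in> U \<and> c \<in> U)"
      using uv by (auto simp: adjacent_via_def U_def doubleton_eq_iff)
    thus ?case using step.IH closed by (meson rtrancl_trans)
  qed auto
  have US: "(a, b) \<in> ?S" if "a \<in> U" "b \<in> U" for a b
  proof -
    have *: "(u, c) \<in> ?S" if "c \<in> U" for c
      using that RS uvS by (auto simp: U_def intro: rtrancl_trans)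
    show ?thesis using *[OF that(1)] *[OF that(2)]
      by (meson adjacent_via_rtrancl_sym rtrancl_trans)
  qed
  have SU: "?S `` {x} = (if x \<in> U then U else ?R `` {x})" for x
  proof (cases "x \<in> U")
    case True
    have "b \<in> U" if "(x, b) \<in> ?S" for b using SE[OF that] closed[of x b] True by blast
    thus ?thesis using US[OF True] True by auto
  next
    case False
    have "(x, b) \<in> ?R" if "(x, b) \<in> ?S" for b using SE[OF that] False by blast
    thus ?thesis using RS False by auto
  qed
  let ?P = "(\<lambda>x. ?R `` {x}) ` verts G"
  \<comment> \<open>Since \<open>U\<close> contains two distinct classes, it is not an old class,
    and inserting it adds one to the count.\<close>
  have U_nonclass: "U \<noteq> ?R `` {x}" for x
  proof
    assume "U = ?R `` {x}"
    hence "(x, u) \<in> ?R" "(x, v) \<in> ?R" by (auto simp: U_def)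
    thus False using uvR symR by (meson rtrancl_trans)
  qed
  have UD: "x \<in> U \<longleftrightarrow> ?R `` {x} = ?R `` {u} \<or> ?R `` {x} = ?R `` {v}" for x
    unfolding component_eq_iff using symR by (auto simp: U_def)
  have u': "u \<in> U" by (auto simp: U_def)
  have "(\<lambda>x. ?S `` {x}) ` verts G = insert U (?P - {?R `` {u}, ?R `` {v}})"
    (is "?Q = _")
  proof
    show "?Q \<subseteq> insert U (?P - {?R `` {u}, ?R `` {v}})"
      unfolding SU using UD by auto
    show "insert U (?P - {?R `` {u}, ?R `` {v}}) \<subseteq> ?Q"
    proof
      fix X assume "X \<in> insert U (?P - {?R `` {u}, ?R `` {v}})"
      then consider "X = U" | x where "x \<in> verts G" "X = ?R `` {x}" "x \<notin> U"
        using UD by auto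
      thus "X \<in> ?Q" unfolding SU using uv u' by cases (force intro!: image_eqI)+
    qed
  qed
  moreover have "finite ?P" using G by (auto simp: multigraph_def)
  moreover have "?R `` {u} \<noteq> ?R `` {v}" using uvR unfolding component_eq_iff .
  moreover have "U \<notin> ?P" using U_nonclass by blast
  moreover have "{?R `` {u}, ?R `` {v}} \<subseteq> ?P" using uv by auto
  \<comment> \<open>At least two classes exist, so the truncated subtraction of 2 in the final count
    is exact.\<close>
  moreover from calculation have "card {?R `` {u}, ?R `` {v}} \<le> card ?P" by (intro card_mono)
  ultimately show ?thesis
    unfolding num_components_def by (simp add: card_Diff_subset)
qed

section \<open>Cycles and spanned edges\<close>

lemma spanned_cycle_remove:
  assumes "cycle_edge_set G C" "m \<in> C"
  shows "spanned G (C - {m}) m"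
proof -
  obtain vs es where len: "length vs = length es" and dist: "distinct es"
    and ends: "\<And>i. i < length es \<Longrightarrow> ends G (es ! i) = {vs ! i, vs ! (Suc i mod length es)}"
    and C: "C = set es"
    using assms(1) by (auto simp: cycle_edge_set_def)
  obtain k where k: "k < length es" "m = es ! k" using assms(2) C by (auto simp: in_set_conv_nth)
  let ?n = "length es" and ?R = "(adjacent_via G (C - {m}))\<^sup>*"
  have n: "?n > 0" using k by auto
  \<comment> \<open>Walk round the cycle from the vertex after \<open>m\<close>. The edges used have
    indices \<open>k + 1\<close> to \<open>k + j\<close> modulo the length, and \<open>j\<close>
    below the length keeps them different from \<open>k\<close>. For \<open>j = ?n - 1\<close> the
    walk arrives at vertex \<open>k\<close>, the other end of \<open>m\<close>.\<close>
  have *: "(vs ! ((k + 1) mod ?n), vs ! ((k + 1 + j) mod ?n)) \<in> ?R" if "j < ?n" for j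
    using that
  proof (induction j)
    case (Suc j)
    let ?i = "(k + 1 + j) mod ?n"
    have i: "?i < ?n" using n by simp
    have "?i \<noteq> k"
    proof (cases "k + 1 + j < ?n")
      case False
      hence "?i = k + 1 + j - ?n" using Suc.prems k by (simp add: le_mod_geq)
      thus ?thesis using Suc.prems k(1) False by linarith
    qed simp
    hence "es ! ?i \<in> C - {m}" using i k dist C by (simp add: nth_eq_iff_index_eq)
    moreover have "ends G (es ! ?i) = {vs ! ?i, vs ! ((k + 1 + Suc j) mod ?n)}"
      using ends[OF i] by (simp add: mod_Suc_eq)
    ultimately have "(vs ! ?i, vs ! ((k + 1 + Suc j) mod ?n)) \<in> adjacent_via G (C - {m})"
      unfolding adjacent_via_def by blast
    thus ?case using Suc by (meson Suc_lessD rtrancl.rtrancl_into_rtrancl)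
  qed simp
  have "k + 1 + (?n - 1) = k + ?n" using n by simp
  hence "(k + 1 + (?n - 1)) mod ?n = k" using k by simp
  hence "(vs ! (Suc k mod ?n), vs ! k) \<in> ?R" using *[of "?n - 1"] n by simp
  thus ?thesis using ends[OF k(1)] adjacent_via_rtrancl_sym unfolding spanned_def k(2)[symmetric]
    by fastforce
qed

text \<open>A path from \<open>u\<close> to \<open>v\<close> in \<open>A\<close> without repeated
  vertices is closed up by \<open>e\<close>. It is nonempty because \<open>u \<noteq> v\<close>, and
  \<open>e\<close> does not repeat one of its edges because \<open>e \<notin> A\<close>.\<close>

lemma cycle_through_spanned_edge:
  assumes e: "e \<in> edges G" "e \<notin> A" and A: "A \<subseteq> edges G" and sp: "spanned G A e"
    and uv: "ends G e = {u, v}" "u \<noteq> v"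
  obtains C where "cycle_edge_set G C" "e \<in> C" "C - {e} \<subseteq> A"
proof -
  let ?r = "\<lambda>a b. (a, b) \<in> adjacent_via G A"
  have "(u, v) \<in> (adjacent_via G A)\<^sup>*" using sp uv by (auto simp: spanned_def)
  hence "?r\<^sup>*\<^sup>* u v" by (simp add: rtranclp_rtrancl_eq)
  then obtain xs0 where "rtrancl_path ?r u xs0 v" unfolding rtranclp_eq_rtrancl_path by blast
  then obtain xs where xs: "rtrancl_path ?r u xs v" and dist: "distinct (u # xs)"
    by (rule rtrancl_path_distinct)
  have ne: "xs \<noteq> []" using xs uv by (auto elim: rtrancl_path.cases)
  have last: "xs ! (length xs - 1) = v"
    using rtrancl_path_last[OF xs ne] ne by (simp add: last_conv_nth)
  \<comment> \<open>The path records only vertices, so an edge of \<open>A\<close> is chosen for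
    each of its steps.\<close>
  define g where "g i = (SOME a. a \<in> A \<and> ends G a = {(u # xs) ! i, xs ! i})" for i
  have g: "g i \<in> A \<and> ends G (g i) = {(u # xs) ! i, xs ! i}" if "i < length xs" for i
  proof -
    have "\<exists>a. a \<in> A \<and> ends G a = {(u # xs) ! i, xs ! i}"
      using rtrancl_path_nth[OF xs that] by (auto simp: adjacent_via_def)
    thus ?thesis unfolding g_def by (rule someI_ex)
  qed
  \<comment> \<open>Equal edges have equal endpoint pairs. As the vertices are distinct, a crossed
    match would force both \<open>i = Suc j\<close> and \<open>Suc i = j\<close>.\<close>
  have g_inj: "i = j" if "i < length xs" "j < length xs" "g i = g j" for i j
  proof -
    let ?w = "u # xs"
    have "{?w ! i, ?w ! Suc i} = {?w ! j, ?w ! Suc j}" using g that by (metis nth_Cons_Suc)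
    hence "(?w ! i = ?w ! j) \<or> (?w ! i = ?w ! Suc j \<and> ?w ! Suc i = ?w ! j)"
      by (auto simp: doubleton_eq_iff)
    moreover have w: "?w ! a = ?w ! b \<longleftrightarrow> a = b" if "a \<le> length xs" "b \<le> length xs" for a b
      using nth_eq_iff_index_eq[OF dist] that by simp
    ultimately show ?thesis
      using that(1,2) w[of i j] w[of i "Suc j"] w[of "Suc i" j] by linarith
  qed
  \<comment> \<open>With \<open>e\<close> last, index \<open>length xs\<close> carries the vertex
    \<open>v\<close>, and its successor wraps round to index 0, which carries
    \<open>u\<close>.\<close>
  define es where "es = map g [0..<length xs] @ [e]"
  have len: "length es = Suc (length xs)" by (simp add: es_def)
  have gA: "g ` {0..<length xs} \<subseteq> A" using g by auto
  have "distinct es" using gA e g_inj by (auto simp: es_def distinct_map inj_on_def)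
  moreover have "set es \<subseteq> edges G" using gA e A by (auto simp: es_def)
  moreover have "ends G (es ! i) = {(u # xs) ! i, (u # xs) ! (Suc i mod length es)}"
    if "i < length es" for i
  proof (cases "i < length xs")
    case True
    thus ?thesis using g[OF True] by (simp add: es_def nth_append)
  next
    case False
    hence "i = length xs" using that len by simp
    thus ?thesis using last ne uv(1) by (auto simp: es_def nth_append nth_Cons')
  qed
  ultimately have "cycle_edge_set G (set es)"
    unfolding cycle_edge_set_def using dist len
    by (intro exI[of _ "u # xs"] exI[of _ es]) auto
  moreover have "e \<in> set es" "set es - {e} \<subseteq> A" using gA by (auto simp: es_def)
  ultimately show ?thesis using that by blast
qed

section \<open>Closing edges and the sign-reversing involution\<close>

definition earlier :: "'e rel \<Rightarrow> 'e \<Rightarrow> 'e set \<Rightarrow> 'e set" where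
  "earlier L e A = {a \<in> A. (a, e) \<in> L \<and> a \<noteq> e}"

text \<open>\<open>e\<close> is a closing edge of \<open>A\<close> iff \<open>A\<close> contains a broken circuit whose missing maximum is \<open>e\<close>;
  \<open>e\<close> itself may or may not lie in \<open>A\<close>.\<close>

definition closing_edges :: "('v, 'e) mgraph \<Rightarrow> 'e rel \<Rightarrow> 'e set \<Rightarrow> 'e set" where
  "closing_edges G L A = {e \<in> edges G. spanned G (earlier L e A) e}"

lemma closing_edges_mono: "A \<subseteq> B \<Longrightarrow> closing_edges G L A \<subseteq> closing_edges G L B"
proof -
  assume "A \<subseteq> B"
  hence "earlier L e A \<subseteq> earlier L e B" for e by (auto simp: earlier_def)
  thus ?thesis by (auto simp: closing_edges_def intro: spanned_mono)
qed

text \<open>Going round a cycle shows that a broken circuit spans its missing maximum by earlier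
  edges. Conversely, a path of edges earlier than \<open>e\<close> closes up to a cycle with maximum
  \<open>e\<close>; looplessness makes the ends of \<open>e\<close> distinct.\<close>

lemma bc_complex_iff_closing_edges:
  assumes G: "multigraph G" "loopless G" and L: "linear_order_on (edges G) L"
  shows "bc_complex G L = {A. A \<subseteq> edges G \<and> closing_edges G L A = {}}"
proof -
  have "(\<exists>B. broken_circuit G L B \<and> B \<subseteq> A) \<longleftrightarrow> closing_edges G L A \<noteq> {}"
    if A: "A \<subseteq> edges G" for A
  proof
    assume "\<exists>B. broken_circuit G L B \<and> B \<subseteq> A"
    then obtain C m where C: "cycle_edge_set G C" "m \<in> C" "\<forall>c\<in>C. (c, m) \<in> L" "C - {m} \<subseteq> A"
      by (auto simp: broken_circuit_def)
    have "C - {m} \<subseteq> earlier L m A" using C by (auto simp: earlier_def)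
    hence "spanned G (earlier L m A) m"
      by (rule spanned_mono[OF spanned_cycle_remove[OF C(1,2)]])
    moreover have "m \<in> edges G" using C by (auto simp: cycle_edge_set_def)
    ultimately show "closing_edges G L A \<noteq> {}" by (auto simp: closing_edges_def)
  next
    assume "closing_edges G L A \<noteq> {}"
    then obtain e where e: "e \<in> edges G" "spanned G (earlier L e A) e"
      by (auto simp: closing_edges_def)
    obtain u v where uv: "ends G e = {u, v}" using multigraph_obtain_ends[OF G(1) e(1)] .
    have "u \<noteq> v" using G(2) e uv by (auto simp: loopless_def)
    moreover have "earlier L e A \<subseteq> edges G" "e \<notin> earlier L e A" using A by (auto simp: earlier_def)
    ultimately obtain C where C: "cycle_edge_set G C" "e \<in> C" "C - {e} \<subseteq> earlier L e A"
      using cycle_through_spanned_edge[OF e(1) _ _ e(2) uv] by metis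
    have "(e, e) \<in> L"
      using L e(1) by (auto simp: order_on_defs refl_on_def)
    hence "\<forall>c\<in>C. (c, e) \<in> L" using C by (auto simp: earlier_def)
    hence "broken_circuit G L (C - {e})" using C by (auto simp: broken_circuit_def)
    moreover have "C - {e} \<subseteq> A" using C by (auto simp: earlier_def)
    ultimately show "\<exists>B. broken_circuit G L B \<and> B \<subseteq> A" by blast
  qed
  thus ?thesis by (auto simp: bc_complex_def)
qed

text \<open>Only edges \<open>f\<close> later than \<open>e\<close> see the insertion. By
  transitivity and antisymmetry, the edges earlier than \<open>e\<close> are also earlier than
  \<open>f\<close>; they already span \<open>e\<close>, so adding \<open>e\<close> leaves the
  connectivity relevant to \<open>f\<close> unchanged.\<close>

lemma closing_edges_insert:
  assumes L: "trans L" "antisym L" and e: "e \<in> closing_edges G L A"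
  shows "closing_edges G L (insert e A) = closing_edges G L A"
proof -
  have "spanned G (earlier L f (insert e A)) f \<longleftrightarrow> spanned G (earlier L f A) f" for f
  proof (cases "(e, f) \<in> L \<and> e \<noteq> f")
    case True
    hence "earlier L e A \<subseteq> earlier L f A"
      using L by (auto simp: earlier_def dest: transD antisymD)
    hence "spanned G (earlier L f A) e"
      using e spanned_mono by (auto simp: closing_edges_def)
    moreover have "earlier L f (insert e A) = insert e (earlier L f A)"
      using True by (auto simp: earlier_def)
    ultimately show ?thesis by (simp add: spanned_def adjacent_via_insert_spanned)
  next
    case False
    hence "earlier L f (insert e A) = earlier L f A" by (auto simp: earlier_def)
    thus ?thesis by simp
  qed
  thus ?thesis by (auto simp: closing_edges_def)
qed

text \<open>The edges earlier than \<open>e\<close> exclude \<open>e\<close>, so \<open>e\<close> is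
  still closing after removal, and the insertion lemma applies to \<open>A - {e}\<close>.\<close>

lemma closing_edges_remove:
  assumes L: "trans L" "antisym L" and e: "e \<in> closing_edges G L A"
  shows "closing_edges G L (A - {e}) = closing_edges G L A"
proof (cases "e \<in> A")
  case True
  have "earlier L e (A - {e}) = earlier L e A" by (auto simp: earlier_def)
  hence "e \<in> closing_edges G L (A - {e})" using e by (simp add: closing_edges_def)
  from closing_edges_insert[OF L this] show ?thesis using True by (simp add: insert_absorb)
qed auto

lemma num_components_insert_closing:
  assumes "e \<in> closing_edges G L A"
  shows "num_components G (insert e A) = num_components G A"
proof (rule num_components_insert_spanned)
  have "earlier L e A \<subseteq> A" by (auto simp: earlier_def)
  thus "spanned G A e" using assms spanned_mono by (auto simp: closing_edges_def)
qed

text \<open>Toggling a closing edge changes the sign of a term, but neither the number of components nor the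
  set of closing edges, so all terms outside the complex cancel.\<close>

lemma signed_component_sum_eq_bc_sum:
  fixes q :: "'a::comm_ring_1"
  assumes G: "multigraph G" "loopless G" and L: "linear_order_on (edges G) L"
  shows "(\<Sum>A\<in>Pow (edges G). q ^ num_components G A * (- 1) ^ card A) =
         (\<Sum>A\<in>bc_complex G L. q ^ num_components G A * (- 1) ^ card A)"
proof -
  define X where "X = {A. A \<subseteq> edges G \<and> closing_edges G L A \<noteq> {}}"
  \<comment> \<open>The choice depends on \<open>A\<close> only through its closing set, which
    toggling preserves. Hence the same edge is picked again, and \<open>toggle\<close> is an
    involution.\<close>
  define pick where "pick A = (SOME e. e \<in> closing_edges G L A)" for A
  define toggle where "toggle A = (if pick A \<in> A then A - {pick A} else insert (pick A) A)" for A
  let ?f = "\<lambda>A. q ^ num_components G A * (- 1) ^ card A"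
  have ord: "trans L" "antisym L" using L by (auto simp: order_on_defs)
  have fin: "finite (edges G)" using G by (simp add: multigraph_def)
  have pick: "pick A \<in> closing_edges G L A" if "A \<in> X" for A
    unfolding pick_def using that by (simp add: X_def some_in_eq)
  have closing: "closing_edges G L (toggle A) = closing_edges G L A" if "A \<in> X" for A
    using closing_edges_insert[OF ord pick[OF that]] closing_edges_remove[OF ord pick[OF that]]
    by (simp add: toggle_def)
  have "sum ?f X = 0"
  proof (rule sum_involution_eq_0[of _ _ toggle])
    fix A assume A: "A \<in> X"
    have finA: "finite A" using A fin finite_subset by (auto simp: X_def)
    have p: "pick A \<in> closing_edges G L A" by (rule pick[OF A])
    have "pick A \<in> edges G" using p by (simp add: closing_edges_def)
    thus "toggle A \<in> X" using A closing[OF A] by (auto simp: X_def toggle_def)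
    have "pick (toggle A) = pick A" using closing[OF A] by (simp add: pick_def)
    thus "toggle (toggle A) = A" by (auto simp: toggle_def)
    show "toggle A \<noteq> A" by (auto simp: toggle_def)
    show "?f (toggle A) + ?f A = 0"
    proof (cases "pick A \<in> A")
      case True
      have "pick A \<in> closing_edges G L (A - {pick A})"
        using closing_edges_remove[OF ord p] p by simp
      from num_components_insert_closing[OF this]
      have "num_components G (A - {pick A}) = num_components G A"
        using True by (simp add: insert_absorb)
      moreover have "card A = Suc (card (A - {pick A}))" by (rule card.remove[OF finA True])
      hence "(- 1) ^ card A = ((- 1) * (- 1) ^ card (A - {pick A}) :: 'a)" by (metis power_Suc)
      ultimately show ?thesis using True by (simp add: toggle_def del: card_Diff_singleton)
    next
      case False
      thus ?thesis using finA num_components_insert_closing[OF p] by (simp add: toggle_def)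
    qed
  qed
  moreover have "Pow (edges G) = bc_complex G L \<union> X" "bc_complex G L \<inter> X = {}"
    by (auto simp: X_def bc_complex_iff_closing_edges[OF G L])
  moreover from this fin have "finite (bc_complex G L)" "finite X"
    by (metis finite_Pow_iff finite_Un)+
  ultimately show ?thesis by (simp add: sum.union_disjoint)
qed

section \<open>Faces as forests, and the h-polynomial as a sum over faces\<close>

lemma linear_order_on_maximum:
  assumes "linear_order_on E L" "finite A" "A \<noteq> {}" "A \<subseteq> E"
  obtains e where "e \<in> A" "\<And>a. a \<in> A \<Longrightarrow> (a, e) \<in> L"
proof -
  have refl: "(a, a) \<in> L" if "a \<in> E" for a
    using assms(1) that by (auto simp: order_on_defs refl_on_def)
  have tot: "(a, b) \<in> L \<or> (b, a) \<in> L" if "a \<in> E" "b \<in> E" for a b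
    using assms(1) that refl[of a] by (cases "a = b") (auto simp: order_on_defs total_on_def)
  have tr: "trans L" using assms(1) by (auto simp: order_on_defs)
  have "\<exists>e\<in>A. \<forall>a\<in>A. (a, e) \<in> L"
    using assms(2-4)
  proof (induction rule: finite_ne_induct)
    case (singleton x)
    thus ?case using refl by auto
  next
    case (insert x F)
    then obtain e where e: "e \<in> F" "\<forall>a\<in>F. (a, e) \<in> L" by auto
    show ?case
    proof (cases "(x, e) \<in> L")
      case False
      hence ex: "(e, x) \<in> L" using tot insert.prems e by auto
      hence "\<forall>a\<in>insert x F. (a, x) \<in> L"
        using e refl insert.prems tr by (auto dest: transD)
      thus ?thesis by auto
    qed (use e in auto)
  qed
  thus ?thesis using that by blast
qed

text \<open>Remove the \<open>L\<close>-largest edge \<open>e\<close> of \<open>A\<close>: what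
  remains is exactly the part of \<open>A\<close> earlier than \<open>e\<close>. Since
  \<open>e\<close> is not closing, this part does not span \<open>e\<close>, so the removal creates
  one component.\<close>

lemma forest_num_components:
  assumes G: "multigraph G" and L: "linear_order_on (edges G) L"
    and A: "A \<subseteq> edges G" "closing_edges G L A = {}"
  shows "num_components G A + card A = card (verts G)"
proof -
  have "finite A" using A G by (auto simp: multigraph_def intro: finite_subset)
  thus ?thesis using A
  proof (induction "card A" arbitrary: A)
    case 0
    have "num_components G {} = card (verts G)"
      unfolding num_components_def by (rule card_image) (auto simp: inj_on_def adjacent_via_def)
    thus ?case using 0 by simp
  next
    case (Suc n)
    have "A \<noteq> {}" using Suc by auto
    obtain e where e: "e \<in> A" "\<And>a. a \<in> A \<Longrightarrow> (a, e) \<in> L"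
      using linear_order_on_maximum[OF L _ \<open>A \<noteq> {}\<close>] Suc.prems by metis
    have "closing_edges G L (A - {e}) = {}"
      using Suc.prems closing_edges_mono[of "A - {e}" A G L] by auto
    hence IH: "num_components G (A - {e}) + card (A - {e}) = card (verts G)"
      using Suc.hyps Suc.prems e by (intro Suc.hyps) auto
    have "A - {e} = earlier L e A" using e by (auto simp: earlier_def)
    hence "\<not> spanned G (A - {e}) e" using Suc.prems e by (auto simp: closing_edges_def)
    from num_components_insert_not_spanned[OF G _ this] have
      "num_components G (A - {e}) = Suc (num_components G A)"
      using e Suc.prems by (simp add: insert_absorb subset_eq)
    moreover have "card A = Suc (card (A - {e}))" by (rule card.remove) (use e Suc.prems in auto)
    ultimately show ?case using IH by simp
  qed
qed

lemma face_num_components: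
  assumes G: "multigraph G" "connected_graph G" "loopless G" and L: "linear_order_on (edges G) L"
    and A: "A \<in> bc_complex G L"
  shows "card A \<le> graph_rank G" "num_components G A = Suc (graph_rank G - card A)"
proof -
  have V: "finite (verts G)" "verts G \<noteq> {}"
    using G by (auto simp: multigraph_def connected_graph_def)
  have eq: "num_components G A + card A = card (verts G)"
    using A forest_num_components[OF G(1) L]
    by (simp add: bc_complex_iff_closing_edges[OF G(1,3) L])
  \<comment> \<open>Having at least one component makes both truncated subtractions exact: the 1 in
    \<open>graph_rank\<close> and \<open>card A\<close> in the conclusion.\<close>
  have "num_components G A \<noteq> 0" using V by (simp add: num_components_def)
  thus "card A \<le> graph_rank G" "num_components G A = Suc (graph_rank G - card A)"
    using eq unfolding graph_rank_def by linarith+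
qed

lemma finite_bc_complex:
  assumes "multigraph G"
  shows "finite (bc_complex G L)"
  by (rule finite_subset[of _ "Pow (edges G)"])
     (use assms in \<open>auto simp: bc_complex_def multigraph_def\<close>)

text \<open>No face exceeds size \<open>graph_rank G\<close>, so grouping by size covers all faces.
  Both identities are then proved face by face.\<close>

lemma h_polynomial_eq_sum_faces:
  assumes G: "multigraph G" "connected_graph G" "loopless G" and L: "linear_order_on (edges G) L"
  shows "h_polynomial G L =
    (\<Sum>A\<in>bc_complex G L. [:0, 1:] ^ card A * (1 - [:0, 1:]) ^ (graph_rank G - card A))"
    (is "_ = sum ?f _")
proof -
  have "sum ?f (bc_complex G L) =
      (\<Sum>i\<le>graph_rank G. \<Sum>A\<in>{A \<in> bc_complex G L. card A = i}. ?f A)"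
    using face_num_components(1)[OF G L]
    by (intro sum.group[symmetric] finite_bc_complex G) auto
  also have "\<dots> = h_polynomial G L"
    unfolding h_polynomial_def by (intro sum.cong) (simp_all add: mult.assoc)
  finally show ?thesis by simp
qed

section \<open>Evaluating the Negami polynomial\<close>

definition unital_ring_hom :: "('a::comm_ring_1 \<Rightarrow> 'b::comm_ring_1) \<Rightarrow> bool" where
  "unital_ring_hom g \<longleftrightarrow> g 0 = 0 \<and> g 1 = 1 \<and>
     (\<forall>a b. g (a + b) = g a + g b) \<and> (\<forall>a b. g (a * b) = g a * g b)"

lemma unital_ring_hom_sum: "unital_ring_hom g \<Longrightarrow> g (sum f S) = (\<Sum>s\<in>S. g (f s))"
  by (induction S rule: infinite_finite_induct) (auto simp: unital_ring_hom_def)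

lemma unital_ring_hom_power: "unital_ring_hom g \<Longrightarrow> g (a ^ n) = g a ^ n"
  by (induction n) (auto simp: unital_ring_hom_def)

text \<open>Passes from coefficients to evaluated polynomials. Three applications, starting from
  \<open>of_int\<close>, show that the nested \<open>eval_txy\<close> is a homomorphism.\<close>

lemma unital_ring_hom_poly_map_poly:
  assumes g: "unital_ring_hom g"
  shows "unital_ring_hom (\<lambda>p. poly (map_poly g p) x)"
proof -
  have g0: "g 0 = 0" and g1: "g 1 = 1" and gadd: "\<And>a b. g (a + b) = g a + g b"
    and gmult: "\<And>a b. g (a * b) = g a * g b"
    using g by (auto simp: unital_ring_hom_def)
  have add: "map_poly g (p + q) = map_poly g p + map_poly g q" for p q
    by (rule poly_eqI) (simp add: coeff_map_poly g0 gadd)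
  have smult: "map_poly g (smult a p) = smult (g a) (map_poly g p)" for a p
    by (rule poly_eqI) (simp add: coeff_map_poly g0 gmult)
  have "poly (map_poly g (p * q)) x = poly (map_poly g p) x * poly (map_poly g q) x" for p q
    by (induction p) (auto simp: add smult map_poly_pCons g0 algebra_simps)
  thus ?thesis unfolding unital_ring_hom_def by (simp add: add g1 map_poly_1')
qed

lemma unital_ring_hom_of_int: "unital_ring_hom of_int"
  by (simp add: unital_ring_hom_def)

lemma unital_ring_hom_eval_txy: "unital_ring_hom (\<lambda>p. eval_txy p t x y)"
  unfolding eval_txy_def by (intro unital_ring_hom_poly_map_poly unital_ring_hom_of_int)

lemma eval_txy_var [simp]:
  "eval_txy var_t t x y = t" "eval_txy var_x t x y = x" "eval_txy var_y t x y = y"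
  by (simp_all add: eval_txy_def var_t_def var_x_def var_y_def map_poly_pCons)

lemma eval_txy_negami_polynomial:
  assumes "multigraph G"
  shows "eval_txy (negami_polynomial G) t x y =
    (\<Sum>A\<in>Pow (edges G). t ^ num_components G A * x ^ card A * y ^ card (edges G - A))"
proof -
  note hom = unital_ring_hom_eval_txy[of t x y]
  have mult: "eval_txy (a * b) t x y = eval_txy a t x y * eval_txy b t x y" for a b
    using hom by (simp add: unital_ring_hom_def)
  have "negami_polynomial G = negami_expansion G"
    using negami_polynomial_unique[OF negami_recursion_expansion assms] by simp
  thus ?thesis
    by (simp add: negami_expansion_def unital_ring_hom_sum[OF hom] mult unital_ring_hom_power[OF hom])
qed

text \<open>The terms agree face by face: \<open>- z * q = 1 - z\<close> supplies the powers of
  \<open>1 - z\<close>, the signs cancel, and division by \<open>q\<close> absorbs the one component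
  in excess of \<open>graph_rank G - card A\<close>.\<close>

lemma h_polynomial_negami:
  fixes z q :: "rat poly fract"
  assumes G: "multigraph G" "connected_graph G" "loopless G" and L: "linear_order_on (edges G) L"
    and z: "z = to_fract [:0, 1:]" and q: "q = (z - 1) / z"
  shows "to_fract (h_polynomial G L)
           = (- z) ^ graph_rank G * (eval_txy (negami_polynomial G) q (- 1) 1 / q)"
proof -
  let ?r = "graph_rank G"
  have hom: "unital_ring_hom (to_fract :: rat poly \<Rightarrow> _)"
    by (simp add: unital_ring_hom_def)
  have z0: "z \<noteq> 0" unfolding z by simp
  \<comment> \<open>\<open>q\<close> is invertible because \<open>[:0, 1:] - 1\<close> is a nonzero
    polynomial, and so nonzero in the fraction field.\<close>
  have "z - 1 = to_fract ([:0, 1:] - 1)" by (simp add: z)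
  moreover have "[:0, 1:] - 1 \<noteq> (0 :: rat poly)" by (simp add: one_pCons)
  ultimately have "z - 1 \<noteq> 0" by (simp only: to_fract_eq_0_iff not_False_eq_True)
  hence q0: "q \<noteq> 0" using z0 by (simp add: q)
  have zq: "- z * q = 1 - z" using z0 by (simp add: q field_simps)
  have summand: "z ^ card A * (1 - z) ^ (?r - card A) =
      (- z) ^ ?r * (q ^ num_components G A * (- 1) ^ card A / q)" if A: "A \<in> bc_complex G L" for A
  proof -
    obtain k where k: "?r = card A + k"
      using face_num_components(1)[OF G L A] le_Suc_ex by blast
    have "num_components G A = Suc k" using face_num_components(2)[OF G L A] k by simp
    hence "(- z) ^ ?r * (q ^ num_components G A * (- 1) ^ card A / q) =
        ((- z) ^ card A * (- 1) ^ card A) * ((- z) ^ k * q ^ k)"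
      using q0 by (simp add: k power_add mult_ac)
    also have "\<dots> = z ^ card A * (1 - z) ^ k"
      by (simp only: power_mult_distrib[symmetric] zq) simp
    finally show ?thesis using k by simp
  qed
  have "to_fract (h_polynomial G L) = (\<Sum>A\<in>bc_complex G L. z ^ card A * (1 - z) ^ (?r - card A))"
    unfolding h_polynomial_eq_sum_faces[OF G L] unital_ring_hom_sum[OF hom]
    by (simp add: unital_ring_hom_power[OF hom] z)
  also have "\<dots> = (- z) ^ ?r * ((\<Sum>A\<in>bc_complex G L. q ^ num_components G A * (- 1) ^ card A) / q)"
    by (simp add: summand sum_distrib_left sum_divide_distrib)
  \<comment> \<open>Setting \<open>y = 1\<close> turns the subset expansion into the signed sum over
    all edge sets, which the involution reduces to faces.\<close>
  also have "(\<Sum>A\<in>bc_complex G L. q ^ num_components G A * (- 1) ^ card A) =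
      eval_txy (negami_polynomial G) q (- 1) 1"
    by (simp add: eval_txy_negami_polynomial[OF G(1)] signed_component_sum_eq_bc_sum[OF G(1,3) L])
  finally show ?thesis .
qed

section \<open>Counting monomials\<close>

definition monomial_degree :: "('e \<Rightarrow>\<^sub>0 nat) \<Rightarrow> nat" where
  "monomial_degree m = (\<Sum>e\<in>Poly_Mapping.keys m. Poly_Mapping.lookup m e)"

text \<open>The geometric series without its constant term: it enumerates the positive exponents of
  a single variable.\<close>

lemma fps_X_div_one_minus_X:
  "fps_X / (1 - fps_X) = (Abs_fps (\<lambda>k. if k = 0 then 0 else 1) :: rat fps)"
proof -
  have "Abs_fps (\<lambda>k. if k = 0 then 0 else 1) * (1 - fps_X) = (fps_X :: rat fps)"
    by (rule fps_ext) (auto simp: algebra_simps fps_mult_fps_X_commute[symmetric])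
  moreover have "1 - fps_X \<noteq> (0 :: rat fps)"
    by (metis eq_iff_diff_eq_0 fps_X_neq_one)
  ultimately show ?thesis by (metis nonzero_mult_div_cancel_right)
qed

section \<open>Monomials with prescribed support\<close>

definition monomials_on :: "'e set \<Rightarrow> nat \<Rightarrow> ('e \<Rightarrow>\<^sub>0 nat) set" where
  "monomials_on F d = {m. Poly_Mapping.keys m = F \<and> monomial_degree m = d}"

lemma monomials_on_empty: "monomials_on {} d = (if d = 0 then {0} else {})"
  by (auto simp: monomials_on_def monomial_degree_def)

text \<open>Split off the power of \<open>x\<close>. Its exponent \<open>k\<close> starts at 1,
  since \<open>x\<close> must occur in the support.\<close>

lemma monomials_on_insert:
  assumes "finite F" "x \<notin> F"
  shows "monomials_on (insert x F) d =
    (\<Union>k\<in>{1..d}. (\<lambda>m. Poly_Mapping.single x k + m) ` monomials_on F (d - k))" (is "?l = ?r")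
proof (intro equalityI subsetI)
  fix m assume m: "m \<in> ?l"
  let ?k = "Poly_Mapping.lookup m x" and ?m = "Poly_Mapping.update x 0 m"
  have keys: "Poly_Mapping.keys m = insert x F" using m by (simp add: monomials_on_def)
  have eq: "m = Poly_Mapping.single x ?k + ?m"
    by (rule poly_mapping_eqI) (auto simp: lookup_add lookup_update lookup_single when_def)
  have keys': "Poly_Mapping.keys ?m = F" using keys assms by (simp add: keys_update)
  have "monomial_degree m = ?k + (\<Sum>e\<in>F. Poly_Mapping.lookup m e)"
    using assms keys by (simp add: monomial_degree_def)
  also have "(\<Sum>e\<in>F. Poly_Mapping.lookup m e) = monomial_degree ?m"
    unfolding monomial_degree_def keys' using assms
    by (intro sum.cong) (auto simp: lookup_update)
  finally have "d = ?k + monomial_degree ?m" using m by (simp add: monomials_on_def)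
  moreover have "?k \<noteq> 0" using keys by (metis in_keys_iff insertI1)
  ultimately show "m \<in> ?r" using eq keys'
    by (intro UN_I[of ?k] image_eqI[of _ _ ?m]) (auto simp: monomials_on_def)
next
  fix m assume "m \<in> ?r"
  then obtain k m' where k: "k \<in> {1..d}" and m': "m' \<in> monomials_on F (d - k)"
    and m: "m = Poly_Mapping.single x k + m'" by auto
  have keys': "Poly_Mapping.keys m' = F" using m' by (simp add: monomials_on_def)
  have x0: "Poly_Mapping.lookup m' x = 0" using keys' assms by (metis in_keys_iff)
  have look: "Poly_Mapping.lookup m e = (if e = x then k else Poly_Mapping.lookup m' e)" for e
    using x0 by (simp add: m lookup_add lookup_single when_def)
  have keys: "Poly_Mapping.keys m = insert x F"
  proof (rule Set.set_eqI)
    fix e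
    have "e \<in> F \<longleftrightarrow> Poly_Mapping.lookup m' e \<noteq> 0" using keys' by (metis in_keys_iff)
    thus "e \<in> Poly_Mapping.keys m \<longleftrightarrow> e \<in> insert x F"
      using k unfolding in_keys_iff look by simp
  qed
  have "monomial_degree m = k + (\<Sum>e\<in>F. Poly_Mapping.lookup m e)"
    using assms keys by (simp add: monomial_degree_def look)
  also have "(\<Sum>e\<in>F. Poly_Mapping.lookup m e) = monomial_degree m'"
    unfolding monomial_degree_def keys' using assms
    by (intro sum.cong) (auto simp: look)
  finally show "m \<in> ?l" using k keys m' by (simp add: monomials_on_def)
qed

lemma finite_monomials_on: "finite F \<Longrightarrow> finite (monomials_on F d)"
proof (induction F arbitrary: d rule: finite_induct)
  case (insert x F)
  show ?case unfolding monomials_on_insert[OF insert.hyps] using insert.IH by blast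
qed (simp add: monomials_on_empty)

text \<open>The exponent at \<open>x\<close> recovers \<open>k\<close>, so the pieces for different
  \<open>k\<close> are disjoint.\<close>

lemma card_monomials_on_insert:
  assumes "finite F" "x \<notin> F"
  shows "card (monomials_on (insert x F) d) = (\<Sum>k=1..d. card (monomials_on F (d - k)))"
proof -
  let ?g = "\<lambda>k m. Poly_Mapping.single x k + m"
  have x0: "Poly_Mapping.lookup m x = 0" if "m \<in> monomials_on F j" for m j
    using that assms unfolding monomials_on_def by (metis (mono_tags) in_keys_iff mem_Collect_eq)
  have look: "Poly_Mapping.lookup m x = i" if "m \<in> ?g i ` monomials_on F (d - i)" for m i
    using that x0 by (auto simp: lookup_add)
  have "?g i ` monomials_on F (d - i) \<inter> ?g j ` monomials_on F (d - j) = {}" if "i \<noteq> j" for i j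
    using look[of _ i] look[of _ j] that by (intro equals0I) (metis IntD1 IntD2)
  hence "card (monomials_on (insert x F) d) = (\<Sum>k=1..d. card (?g k ` monomials_on F (d - k)))"
    unfolding monomials_on_insert[OF assms] using assms
    by (intro card_UN_disjoint) (auto simp: finite_monomials_on)
  also have "\<dots> = (\<Sum>k=1..d. card (monomials_on F (d - k)))"
    by (intro sum.cong card_image) (auto simp: inj_on_def)
  finally show ?thesis .
qed

text \<open>The counting recursion is a Cauchy product with the geometric series, so each element of
  \<open>F\<close> contributes one factor.\<close>

lemma monomials_on_generating_function:
  assumes "finite F"
  shows "Abs_fps (\<lambda>d. of_nat (card (monomials_on F d))) = ((fps_X / (1 - fps_X)) ^ card F :: rat fps)"
  using assms
proof (induction F rule: finite_induct)
  case empty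
  show ?case by (rule fps_ext) (simp add: monomials_on_empty)
next
  case (insert x F)
  let ?a = "\<lambda>d. of_nat (card (monomials_on F d)) :: rat"
  have "Abs_fps (\<lambda>k. if k = 0 then 0 else 1) * Abs_fps ?a =
      Abs_fps (\<lambda>d. of_nat (card (monomials_on (insert x F) d)))"
  proof (rule fps_ext)
    fix d
    \<comment> \<open>The Cauchy product starts at \<open>k = 0\<close>, where the geometric series
      has coefficient 0.\<close>
    have "(\<Sum>k=0..d. (if k = 0 then 0 else 1) * ?a (d - k)) = (\<Sum>k=1..d. ?a (d - k))"
      by (rule sum.mono_neutral_cong_right) auto
    thus "fps_nth (Abs_fps (\<lambda>k. if k = 0 then 0 else 1) * Abs_fps ?a) d =
        fps_nth (Abs_fps (\<lambda>d. of_nat (card (monomials_on (insert x F) d)))) d"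
      by (simp add: fps_mult_nth card_monomials_on_insert[OF insert.hyps])
  qed
  thus ?case using insert by (simp add: fps_X_div_one_minus_X)
qed

section \<open>Squarefree monomial ideals\<close>

lemma polynomial_ring_simps [simp]:
  "p \<in> carrier (polynomial_ring E) \<longleftrightarrow> (\<forall>m\<in>Poly_Mapping.keys p. Poly_Mapping.keys m \<subseteq> E)"
  "p \<otimes>\<^bsub>polynomial_ring E\<^esub> q = p * q" "\<one>\<^bsub>polynomial_ring E\<^esub> = 1"
  "\<zero>\<^bsub>polynomial_ring E\<^esub> = 0" "p \<oplus>\<^bsub>polynomial_ring E\<^esub> q = p + q"
  by (simp_all add: polynomial_ring_def)

text \<open>Exponents are natural numbers, so nothing cancels: multiplying monomials unites their
  supports.\<close>

lemma keys_monomial_add: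
  "Poly_Mapping.keys (m + n :: 'e \<Rightarrow>\<^sub>0 nat) = Poly_Mapping.keys m \<union> Poly_Mapping.keys n"
  by (rule Set.set_eqI) (simp add: in_keys_iff lookup_add del: lookup_not_eq_zero_eq_in_keys)

lemma polynomial_ring_carrier_add:
  fixes p q :: "('e \<Rightarrow>\<^sub>0 nat) \<Rightarrow>\<^sub>0 'k::field"
  assumes "p \<in> carrier (polynomial_ring E)" "q \<in> carrier (polynomial_ring E)"
  shows "p + q \<in> carrier (polynomial_ring E)"
  using assms keys_add[of p q] unfolding polynomial_ring_simps by blast

lemma polynomial_ring_carrier_mult:
  fixes p q :: "('e \<Rightarrow>\<^sub>0 nat) \<Rightarrow>\<^sub>0 'k::field"
  assumes "p \<in> carrier (polynomial_ring E)" "q \<in> carrier (polynomial_ring E)"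
  shows "p * q \<in> carrier (polynomial_ring E)"
  unfolding polynomial_ring_simps
proof
  fix m assume "m \<in> Poly_Mapping.keys (p * q)"
  then obtain a b where "m = a + b" "a \<in> Poly_Mapping.keys p" "b \<in> Poly_Mapping.keys q"
    using keys_mult[of p q] by blast
  thus "Poly_Mapping.keys m \<subseteq> E" using assms by (simp add: keys_monomial_add)
qed

lemma cring_polynomial_ring: "cring (polynomial_ring E :: (('e \<Rightarrow>\<^sub>0 nat) \<Rightarrow>\<^sub>0 'k::field) ring)"
    (is "cring ?P")
proof (rule cringI)
  show "abelian_group ?P"
  proof (rule abelian_groupI)
    fix p assume "p \<in> carrier ?P"
    hence "- p \<in> carrier ?P" "(- p) \<oplus>\<^bsub>?P\<^esub> p = \<zero>\<^bsub>?P\<^esub>" by simp_all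
    thus "\<exists>q\<in>carrier ?P. q \<oplus>\<^bsub>?P\<^esub> p = \<zero>\<^bsub>?P\<^esub>" by blast
  next
    fix p q assume "p \<in> carrier ?P" "q \<in> carrier ?P"
    thus "p \<oplus>\<^bsub>?P\<^esub> q \<in> carrier ?P"
      using polynomial_ring_carrier_add by simp
  qed (auto simp: algebra_simps)
  show "comm_monoid ?P"
  proof (rule comm_monoidI)
    fix p q assume "p \<in> carrier ?P" "q \<in> carrier ?P"
    thus "p \<otimes>\<^bsub>?P\<^esub> q \<in> carrier ?P"
      using polynomial_ring_carrier_mult by simp
  qed (auto simp: algebra_simps)
qed (simp add: algebra_simps)

lemma polynomial_ring_uminus:
  fixes p :: "('e \<Rightarrow>\<^sub>0 nat) \<Rightarrow>\<^sub>0 'k::field"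
  assumes "p \<in> carrier (polynomial_ring E)"
  shows "\<ominus>\<^bsub>polynomial_ring E\<^esub> p = - p"
proof -
  interpret cring "polynomial_ring E :: (('e \<Rightarrow>\<^sub>0 nat) \<Rightarrow>\<^sub>0 'k) ring" by (rule cring_polynomial_ring)
  show ?thesis by (rule minus_equality) (use assms in simp_all)
qed

lemma polynomial_ring_minus:
  fixes p q :: "('e \<Rightarrow>\<^sub>0 nat) \<Rightarrow>\<^sub>0 'k::field"
  assumes "q \<in> carrier (polynomial_ring E)"
  shows "p \<ominus>\<^bsub>polynomial_ring E\<^esub> q = p - q"
  using polynomial_ring_uminus[OF assms] by (simp add: a_minus_def)

lemma subfield_range_const_poly:
  "subfield (range const_poly) (polynomial_ring E :: (('e \<Rightarrow>\<^sub>0 nat) \<Rightarrow>\<^sub>0 'k::field) ring)"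
    (is "subfield ?K ?P")
proof -
  interpret cring ?P by (rule cring_polynomial_ring)
  have const_carrier: "const_poly c \<in> carrier ?P" for c by (simp add: const_poly_def)
  have one: "const_poly 1 = (1 :: ('e \<Rightarrow>\<^sub>0 nat) \<Rightarrow>\<^sub>0 'k)" by (simp add: const_poly_def)
  have zero_iff: "const_poly c = (0 :: ('e \<Rightarrow>\<^sub>0 nat) \<Rightarrow>\<^sub>0 'k) \<longleftrightarrow> c = 0" for c
    by (metis const_poly_def lookup_single_eq lookup_zero single_zero)
  have mult: "const_poly a * const_poly b = (const_poly (a * b) :: ('e \<Rightarrow>\<^sub>0 nat) \<Rightarrow>\<^sub>0 'k)" for a b
    by (simp add: const_poly_def mult_single)
  have subring: "subring ?K ?P"
  proof (rule subringI)
    show "?K \<subseteq> carrier ?P" using const_carrier by blast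
    show "\<one>\<^bsub>?P\<^esub> \<in> ?K" using one by (metis polynomial_ring_simps(3) rangeI)
  next
    fix h assume "h \<in> ?K"
    then obtain c where h: "h = const_poly c" by blast
    have "\<ominus>\<^bsub>?P\<^esub> h = const_poly (- c)"
      using polynomial_ring_uminus[OF const_carrier, of c]
      unfolding h by (simp add: const_poly_def single_uminus)
    thus "\<ominus>\<^bsub>?P\<^esub> h \<in> ?K" by simp
  next
    fix h1 h2 assume "h1 \<in> ?K" "h2 \<in> ?K"
    then obtain a b where h: "h1 = const_poly a" "h2 = const_poly b" by blast
    show "h1 \<otimes>\<^bsub>?P\<^esub> h2 \<in> ?K" by (simp add: h mult)
    have "h1 + h2 = const_poly (a + b)" by (simp add: h const_poly_def single_add)
    thus "h1 \<oplus>\<^bsub>?P\<^esub> h2 \<in> ?K" by simp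
  qed
  show ?thesis
  proof (rule subfieldI[OF subcringI'[OF subring]])
    show "Units (?P\<lparr>carrier := ?K\<rparr>) = ?K - {\<zero>\<^bsub>?P\<^esub>}"
    proof (intro equalityI subsetI)
      fix h assume "h \<in> Units (?P\<lparr>carrier := ?K\<rparr>)"
      then obtain h' where "h \<in> ?K" "h' * h = 1" by (auto simp: Units_def)
      thus "h \<in> ?K - {\<zero>\<^bsub>?P\<^esub>}" by auto
    next
      fix h assume "h \<in> ?K - {\<zero>\<^bsub>?P\<^esub>}"
      then obtain c where c: "h = const_poly c" "c \<noteq> 0" using zero_iff by auto
      have "const_poly (inverse c) * h = 1" "h * const_poly (inverse c) = 1"
        using c(2) by (simp_all add: c(1) mult one)
      thus "h \<in> Units (?P\<lparr>carrier := ?K\<rparr>)"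
        unfolding Units_def using c(1) by auto
    qed
  qed
qed

section \<open>Dimensions of spans of monomials\<close>

lemma poly_mapping_sum_single:
  fixes p :: "'a \<Rightarrow>\<^sub>0 'b::comm_monoid_add"
  shows "p = (\<Sum>m\<in>Poly_Mapping.keys p. Poly_Mapping.single m (Poly_Mapping.lookup p m))"
  by (rule poly_mapping_eqI)
     (simp add: lookup_sum lookup_single when_def not_in_keys_iff_lookup_eq_zero)

text \<open>Splitting off the coefficient of a new monomial exhibits a line extension. That monomial
  lies outside the span of the others, so the dimension rises by one.\<close>

lemma dimension_monomial_span:
  fixes M :: "('e \<Rightarrow>\<^sub>0 nat) set"
  assumes "finite M" "\<And>m. m \<in> M \<Longrightarrow> Poly_Mapping.keys m \<subseteq> E"
  shows "ring.dimension (polynomial_ring E) (card M) (range const_poly)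
    {p :: ('e \<Rightarrow>\<^sub>0 nat) \<Rightarrow>\<^sub>0 'k::field. Poly_Mapping.keys p \<subseteq> M}"
proof -
  let ?P = "polynomial_ring E :: (('e \<Rightarrow>\<^sub>0 nat) \<Rightarrow>\<^sub>0 'k) ring"
  let ?K = "range const_poly :: (('e \<Rightarrow>\<^sub>0 nat) \<Rightarrow>\<^sub>0 'k) set"
  interpret cring ?P by (rule cring_polynomial_ring)
  show ?thesis using assms
  proof (induction M rule: finite_induct)
    case empty
    have "{p :: ('e \<Rightarrow>\<^sub>0 nat) \<Rightarrow>\<^sub>0 'k. Poly_Mapping.keys p \<subseteq> {}} = {\<zero>\<^bsub>?P\<^esub>}" by auto
    thus ?case using zero_dim[of ?K] by simp
  next
    case (insert m M)
    let ?S = "\<lambda>M. {p :: ('e \<Rightarrow>\<^sub>0 nat) \<Rightarrow>\<^sub>0 'k. Poly_Mapping.keys p \<subseteq> M}"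
    have smult: "const_poly c * Poly_Mapping.single m 1 = Poly_Mapping.single m (c :: 'k)" for c
      by (simp add: const_poly_def mult_single)
    have "?S (insert m M) = line_extension ?K (Poly_Mapping.single m 1) (?S M)"
    proof (intro equalityI subsetI)
      fix p assume p: "p \<in> ?S (insert m M)"
      let ?c = "Poly_Mapping.lookup p m"
      have "Poly_Mapping.keys (p - Poly_Mapping.single m ?c) \<subseteq> M"
      proof
        fix n assume "n \<in> Poly_Mapping.keys (p - Poly_Mapping.single m ?c)"
        hence n: "Poly_Mapping.lookup (p - Poly_Mapping.single m ?c) n \<noteq> 0"
          by (metis in_keys_iff)
        hence "n \<noteq> m" by (auto simp: lookup_minus)
        hence "Poly_Mapping.lookup p n \<noteq> 0" using n by (simp add: lookup_minus lookup_single when_def)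
        thus "n \<in> M" using p \<open>n \<noteq> m\<close> by (auto simp: in_keys_iff[symmetric])
      qed
      moreover have "p = const_poly ?c \<otimes>\<^bsub>?P\<^esub> Poly_Mapping.single m 1
          \<oplus>\<^bsub>?P\<^esub> (p - Poly_Mapping.single m ?c)"
        by (simp add: smult)
      ultimately show "p \<in> line_extension ?K (Poly_Mapping.single m 1) (?S M)"
        unfolding line_extension_mem_iff by blast
    next
      fix p assume "p \<in> line_extension ?K (Poly_Mapping.single m 1) (?S M)"
      then obtain c v where v: "Poly_Mapping.keys v \<subseteq> M" and p: "p = Poly_Mapping.single m c + v"
        unfolding line_extension_mem_iff by (auto simp: smult)
      have "Poly_Mapping.keys p \<subseteq> Poly_Mapping.keys (Poly_Mapping.single m c) \<union> Poly_Mapping.keys v"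
        unfolding p by (rule keys_add)
      thus "p \<in> ?S (insert m M)" using v by (auto split: if_splits)
    qed
    moreover have "Poly_Mapping.single m 1 \<in> carrier ?P" using insert.prems by simp
    moreover have "Poly_Mapping.single m 1 \<notin> ?S M" using insert.hyps by simp
    moreover have "dimension (card M) ?K (?S M)" using insert.IH insert.prems by simp
    ultimately show ?case using insert.hyps Suc_dim by simp
  qed
qed

section \<open>Ideals generated by squarefree monomials\<close>

definition squarefree_monomial :: "'e set \<Rightarrow> 'e \<Rightarrow>\<^sub>0 nat" where
  "squarefree_monomial B = (\<Sum>e\<in>B. Poly_Mapping.single e 1)"

lemma lookup_squarefree_monomial:
  "finite B \<Longrightarrow> Poly_Mapping.lookup (squarefree_monomial B) e = (if e \<in> B then 1 else 0)"
  by (simp add: squarefree_monomial_def lookup_sum lookup_single when_def)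

lemma keys_squarefree_monomial: "finite B \<Longrightarrow> Poly_Mapping.keys (squarefree_monomial B) = B"
  by (rule Set.set_eqI)
     (simp add: in_keys_iff lookup_squarefree_monomial del: lookup_not_eq_zero_eq_in_keys)

lemma prod_variable:
  "(\<Prod>e\<in>B. variable e) = (Poly_Mapping.single (squarefree_monomial B) 1 :: ('e \<Rightarrow>\<^sub>0 nat) \<Rightarrow>\<^sub>0 'k::field)"
  by (induction B rule: infinite_finite_induct)
     (simp_all add: squarefree_monomial_def variable_def mult_single)

text \<open>The right-hand side is an ideal because supports only grow under multiplication, and it
  contains the generators. Conversely, each monomial of a member is a multiple of a
  generator.\<close>

lemma genideal_squarefree_monomials:
  assumes N: "\<And>B. B \<in> N \<Longrightarrow> finite B \<and> B \<subseteq> E"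
  shows "Idl\<^bsub>polynomial_ring E\<^esub> ((\<lambda>B. \<Prod>e\<in>B. variable e) ` N) =
    {p \<in> carrier (polynomial_ring E) :: (('e \<Rightarrow>\<^sub>0 nat) \<Rightarrow>\<^sub>0 'k::field) set.
       \<forall>m\<in>Poly_Mapping.keys p. \<exists>B\<in>N. B \<subseteq> Poly_Mapping.keys m}"
    (is "Idl\<^bsub>?P\<^esub> ?g = ?I")
proof
  interpret cring ?P by (rule cring_polynomial_ring)
  have ideal: "ideal ?I ?P"
  proof (rule idealI)
    show "ring ?P" by (rule ring_axioms)
    show "subgroup ?I (add_monoid ?P)"
    proof (rule add.subgroupI)
      have "0 \<in> ?I" by simp
      thus "?I \<noteq> {}" by (metis empty_iff)
    next
      fix a assume "a \<in> ?I"
      thus "\<ominus>\<^bsub>?P\<^esub> a \<in> ?I" by (simp add: polynomial_ring_uminus)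
    next
      fix a b assume ab: "a \<in> ?I" "b \<in> ?I"
      have "Poly_Mapping.keys (a + b) \<subseteq> Poly_Mapping.keys a \<union> Poly_Mapping.keys b" by (rule keys_add)
      thus "a \<oplus>\<^bsub>?P\<^esub> b \<in> ?I"
        using ab unfolding mem_Collect_eq polynomial_ring_simps by blast
    qed blast
    have closed: "a * x \<in> ?I" if ax: "a \<in> ?I" "x \<in> carrier ?P" for a x
    proof -
      have "\<exists>B\<in>N. B \<subseteq> Poly_Mapping.keys m" if m: "m \<in> Poly_Mapping.keys (a * x)" for m
      proof -
        obtain c d where cd: "m = c + d" "c \<in> Poly_Mapping.keys a"
          using m keys_mult[of a x] by blast
        then obtain B where "B \<in> N" "B \<subseteq> Poly_Mapping.keys c" using ax(1) by blast
        thus ?thesis by (auto simp: cd(1) keys_monomial_add)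
      qed
      thus ?thesis using ax polynomial_ring_carrier_mult by blast
    qed
    fix a x assume ax: "a \<in> ?I" "x \<in> carrier ?P"
    show "a \<otimes>\<^bsub>?P\<^esub> x \<in> ?I" using closed[OF ax] by (simp only: polynomial_ring_simps)
    show "x \<otimes>\<^bsub>?P\<^esub> a \<in> ?I" using closed[OF ax] by (simp only: polynomial_ring_simps mult.commute)
  qed
  have gI: "?g \<subseteq> ?I"
  proof (rule image_subsetI)
    fix B assume "B \<in> N"
    thus "(\<Prod>e\<in>B. variable e) \<in> ?I"
      using N[of B] by (auto simp: prod_variable keys_squarefree_monomial)
  qed
  thus "Idl\<^bsub>?P\<^esub> ?g \<subseteq> ?I" by (rule genideal_minimal[OF ideal])
  have "?g \<subseteq> carrier ?P" using gI by blast
  note J = genideal_ideal[OF this] genideal_self[OF this]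
  interpret J: ideal "Idl\<^bsub>?P\<^esub> ?g" ?P by (rule J(1))
  show "?I \<subseteq> Idl\<^bsub>?P\<^esub> ?g"
  proof
    fix p assume p: "p \<in> ?I"
    have mono: "Poly_Mapping.single m c \<in> Idl\<^bsub>?P\<^esub> ?g" if m: "m \<in> Poly_Mapping.keys p" for m c
    proof -
      obtain B where B: "B \<in> N" "B \<subseteq> Poly_Mapping.keys m" using p m by blast
      let ?s = "squarefree_monomial B"
      \<comment> \<open>\<open>m - ?s\<close> is the quotient monomial. The pointwise truncated
        subtraction is exact because every element of \<open>B\<close> has exponent at least 1 in
        \<open>m\<close>.\<close>
      have m_eq: "m = ?s + (m - ?s)"
      proof (rule poly_mapping_eqI)
        fix e
        have "Poly_Mapping.lookup ?s e \<le> Poly_Mapping.lookup m e"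
        proof (cases "e \<in> B")
          case True
          hence "Poly_Mapping.lookup m e \<noteq> 0" using B(2) by (metis in_keys_iff subsetD)
          thus ?thesis using N[OF B(1)] by (simp add: lookup_squarefree_monomial)
        qed (use N[OF B(1)] in \<open>simp add: lookup_squarefree_monomial\<close>)
        thus "Poly_Mapping.lookup m e = Poly_Mapping.lookup (?s + (m - ?s)) e"
          by (simp add: lookup_add lookup_minus)
      qed
      have "Poly_Mapping.keys (m - ?s) \<subseteq> Poly_Mapping.keys m"
        by (metis Un_upper2 keys_monomial_add m_eq)
      hence "Poly_Mapping.single (m - ?s) c \<in> carrier ?P" using p m by (auto split: if_splits)
      moreover have "Poly_Mapping.single ?s 1 \<in> Idl\<^bsub>?P\<^esub> ?g"
        using subsetD[OF J(2) imageI[OF B(1)]] by (simp only: prod_variable)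
      ultimately have "Poly_Mapping.single ?s 1 \<otimes>\<^bsub>?P\<^esub> Poly_Mapping.single (m - ?s) c \<in> Idl\<^bsub>?P\<^esub> ?g"
        using J.I_r_closed by blast
      thus ?thesis using m_eq by (simp add: mult_single)
    qed
    \<comment> \<open>Stated for finite subsets of the support so that induction applies; the whole
      support then yields \<open>p\<close>.\<close>
    have "(\<Sum>m\<in>S. Poly_Mapping.single m (Poly_Mapping.lookup p m)) \<in> Idl\<^bsub>?P\<^esub> ?g"
      if "finite S" "S \<subseteq> Poly_Mapping.keys p" for S
      using that
    proof (induction S rule: finite_induct)
      case empty
      show ?case using J.zero_closed by simp
    next
      case (insert m S)
      thus ?case using J.a_closed[OF mono, of m] by simp
    qed
    from this[OF finite_keys order_refl] show "p \<in> Idl\<^bsub>?P\<^esub> ?g"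
      by (simp only: poly_mapping_sum_single[symmetric])
  qed
qed

section \<open>The Hilbert series\<close>

text \<open>Without loops the empty set spans no edge. This keeps 1 out of the ideal, so the
  quotient ring is not zero.\<close>

lemma empty_in_bc_complex:
  assumes "multigraph G" "loopless G" "linear_order_on (edges G) L"
  shows "{} \<in> bc_complex G L"
proof -
  have "\<not> spanned G {} e" if e: "e \<in> edges G" for e
  proof -
    have "card (ends G e) = 2" using assms e by (auto simp: multigraph_def loopless_def)
    then obtain u v where "ends G e = {u, v}" "u \<noteq> v" by (auto simp: card_2_iff)
    thus ?thesis by (auto simp: spanned_def adjacent_via_def)
  qed
  thus ?thesis
    by (simp add: bc_complex_iff_closing_edges[OF assms] closing_edges_def earlier_def)
qed

lemma bc_ideal_eq:
  assumes G: "multigraph G"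
  shows "bc_ideal G L = {p \<in> carrier (polynomial_ring (edges G)) :: (('e \<Rightarrow>\<^sub>0 nat) \<Rightarrow>\<^sub>0 'k::field) set.
           \<forall>m\<in>Poly_Mapping.keys p. Poly_Mapping.keys m \<notin> bc_complex G L}"
proof -
  let ?N = "{B. broken_circuit G L B}"
  have "B \<subseteq> edges G" if "B \<in> ?N" for B
    using that by (auto simp: broken_circuit_def cycle_edge_set_def)
  hence N: "finite B \<and> B \<subseteq> edges G" if "B \<in> ?N" for B
    using that G by (auto simp: multigraph_def intro: finite_subset)
  have "{\<Prod>e\<in>B. variable e :: ('e \<Rightarrow>\<^sub>0 nat) \<Rightarrow>\<^sub>0 'k | B. broken_circuit G L B} =
      (\<lambda>B. \<Prod>e\<in>B. variable e) ` ?N" by auto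
  hence "bc_ideal G L = {p \<in> carrier (polynomial_ring (edges G)) :: (('e \<Rightarrow>\<^sub>0 nat) \<Rightarrow>\<^sub>0 'k) set.
       \<forall>m\<in>Poly_Mapping.keys p. \<exists>B\<in>?N. B \<subseteq> Poly_Mapping.keys m}"
    using genideal_squarefree_monomials[of ?N "edges G", OF N] by (simp add: bc_ideal_def)
  thus ?thesis unfolding bc_complex_def by auto
qed

lemma finite_bc_complex_member: "multigraph G \<Longrightarrow> F \<in> bc_complex G L \<Longrightarrow> finite F"
  by (rule finite_subset[of _ "edges G"]) (auto simp: bc_complex_def multigraph_def)

text \<open>The residue map restricts to a linear bijection from the span of the
  degree-\<open>d\<close> face monomials onto the graded part, so the dimension is the number of
  these monomials.\<close>

lemma bc_graded_part_dimension:
  fixes G :: "('v, 'e) mgraph"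
  assumes G: "multigraph G" "loopless G" and L: "linear_order_on (edges G) L"
  shows "(THE n. ring.dimension (bc_ring G L) n
      (bc_scalars G L :: (('e \<Rightarrow>\<^sub>0 nat) \<Rightarrow>\<^sub>0 'k::field) set set) (bc_graded_part G L d)) =
    (\<Sum>F\<in>bc_complex G L. card (monomials_on F d))"
proof -
  let ?P = "polynomial_ring (edges G) :: (('e \<Rightarrow>\<^sub>0 nat) \<Rightarrow>\<^sub>0 'k) ring"
  let ?I = "bc_ideal G L :: (('e \<Rightarrow>\<^sub>0 nat) \<Rightarrow>\<^sub>0 'k) set"
  let ?h = "bc_residue G L :: (('e \<Rightarrow>\<^sub>0 nat) \<Rightarrow>\<^sub>0 'k) \<Rightarrow> _"
  let ?K = "range const_poly :: (('e \<Rightarrow>\<^sub>0 nat) \<Rightarrow>\<^sub>0 'k) set"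
  let ?span = "\<lambda>M. {p :: ('e \<Rightarrow>\<^sub>0 nat) \<Rightarrow>\<^sub>0 'k. Poly_Mapping.keys p \<subseteq> M}"
  define M where "M = (\<Union>F\<in>bc_complex G L. monomials_on F d)"
  note I_eq = bc_ideal_eq[OF G(1)]
  interpret P: cring ?P by (rule cring_polynomial_ring)
  have "{\<Prod>e\<in>B. variable e :: ('e \<Rightarrow>\<^sub>0 nat) \<Rightarrow>\<^sub>0 'k | B. broken_circuit G L B} \<subseteq> carrier ?P"
  proof
    fix p :: "('e \<Rightarrow>\<^sub>0 nat) \<Rightarrow>\<^sub>0 'k"
    assume "p \<in> {\<Prod>e\<in>B. variable e | B. broken_circuit G L B}"
    then obtain B where B: "broken_circuit G L B" and p: "p = (\<Prod>e\<in>B. variable e)" by blast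
    have "B \<subseteq> edges G" using B by (auto simp: broken_circuit_def cycle_edge_set_def)
    hence "finite B" "B \<subseteq> edges G" using G by (auto simp: multigraph_def intro: finite_subset)
    thus "p \<in> carrier ?P" by (simp add: p prod_variable keys_squarefree_monomial)
  qed
  hence ideal: "ideal ?I ?P" unfolding bc_ideal_def by (rule P.genideal_ideal)
  have h: "?h = (+>\<^bsub>?P\<^esub>) ?I" by (rule ext) (simp add: bc_residue_def)
  interpret h: ring_hom_ring ?P "bc_ring G L" ?h
    unfolding bc_ring_def h by (rule ideal.rcos_ring_hom_ring[OF ideal])
  have h_eq: "?h p = ?h q \<longleftrightarrow> p - q \<in> ?I" if "p \<in> carrier ?P" "q \<in> carrier ?P" for p q
    using P.quotient_eq_iff_same_a_r_cos[OF ideal that] polynomial_ring_minus[OF that(2)]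
    by (simp add: h)
  have face_carrier: "p \<in> carrier ?P" if "\<forall>m\<in>Poly_Mapping.keys p. Poly_Mapping.keys m \<in> bc_complex G L" for p
    using that by (auto simp: bc_complex_def)
  \<comment> \<open>Every monomial of \<open>p - q\<close> has a face as support, whereas membership
    in the ideal forbids face supports; so the difference vanishes.\<close>
  have inj: "p = q"
    if p: "\<forall>m\<in>Poly_Mapping.keys p. Poly_Mapping.keys m \<in> bc_complex G L"
      and q: "\<forall>m\<in>Poly_Mapping.keys q. Poly_Mapping.keys m \<in> bc_complex G L"
      and "?h p = ?h q" for p q
  proof -
    have "p - q \<in> ?I" using h_eq face_carrier that by blast
    moreover have "Poly_Mapping.keys (p - q) \<subseteq> Poly_Mapping.keys p \<union> Poly_Mapping.keys q"
      by (rule keys_diff)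
    ultimately have "Poly_Mapping.keys (p - q) = {}" using p q unfolding I_eq by blast
    thus ?thesis by simp
  qed
  have M_iff: "m \<in> M \<longleftrightarrow> Poly_Mapping.keys m \<in> bc_complex G L \<and> monomial_degree m = d" for m
    by (auto simp: M_def monomials_on_def)
  have finM: "finite M"
    unfolding M_def using finite_bc_complex[OF G(1)] finite_bc_complex_member[OF G(1)]
    by (auto simp: finite_monomials_on)
  have M_sub: "Poly_Mapping.keys m \<subseteq> edges G" if "m \<in> M" for m
    using that by (auto simp: M_iff bc_complex_def)
  \<comment> \<open>A nonzero quotient is required for the constants to map to a subfield and for
    dimensions to transfer.\<close>
  have one_ne: "\<one>\<^bsub>bc_ring G L\<^esub> \<noteq> \<zero>\<^bsub>(bc_ring G L :: (('e \<Rightarrow>\<^sub>0 nat) \<Rightarrow>\<^sub>0 'k) set ring)\<^esub>"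
  proof
    assume "\<one>\<^bsub>bc_ring G L\<^esub> = \<zero>\<^bsub>(bc_ring G L :: (('e \<Rightarrow>\<^sub>0 nat) \<Rightarrow>\<^sub>0 'k) set ring)\<^esub>"
    hence "?h 1 = ?h 0" using h.hom_one h.hom_zero by simp
    hence "(1 :: ('e \<Rightarrow>\<^sub>0 nat) \<Rightarrow>\<^sub>0 'k) = 0"
      by (intro inj) (simp_all add: empty_in_bc_complex[OF G L])
    thus False by simp
  qed
  have K: "subfield ?K ?P" by (rule subfield_range_const_poly)
  have hK: "?h ` ?K = bc_scalars G L" by (auto simp: bc_scalars_def)
  have span: "?h ` ?span M = bc_graded_part G L d"
  proof (intro equalityI subsetI)
    fix y assume "y \<in> ?h ` ?span M"
    then obtain p where p: "Poly_Mapping.keys p \<subseteq> M" and y: "y = ?h p" by blast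
    have "p \<in> carrier ?P" using p M_sub by auto
    moreover have "homogeneous d p"
      using p by (auto simp: homogeneous_def M_iff monomial_degree_def)
    ultimately show "y \<in> bc_graded_part G L d" unfolding bc_graded_part_def y by blast
  next
    fix y :: "(('e \<Rightarrow>\<^sub>0 nat) \<Rightarrow>\<^sub>0 'k) set"
    assume "y \<in> bc_graded_part G L d"
    then obtain p where p: "p \<in> carrier ?P" "homogeneous d p" and y: "y = ?h p"
      unfolding bc_graded_part_def by blast
    \<comment> \<open>Keep only the face monomials of \<open>p\<close>. As \<open>p\<close> is
      homogeneous of degree \<open>d\<close>, each discarded monomial fails to lie in
      \<open>M\<close> because of its support, so \<open>p - p'\<close> belongs to the
      ideal.\<close>
    define p' where "p' = (\<Sum>m\<in>M. Poly_Mapping.single m (Poly_Mapping.lookup p m))"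
    have look: "Poly_Mapping.lookup p' m = (if m \<in> M then Poly_Mapping.lookup p m else 0)" for m
      using finM by (simp add: p'_def lookup_sum lookup_single when_def)
    have p'M: "Poly_Mapping.keys p' \<subseteq> M"
    proof
      fix m assume "m \<in> Poly_Mapping.keys p'"
      thus "m \<in> M" using look by (metis in_keys_iff)
    qed
    have p'c: "p' \<in> carrier ?P" using p'M M_sub by auto
    have "p - p' \<in> carrier ?P"
      using P.minus_closed[OF p(1) p'c] polynomial_ring_minus[OF p'c] by simp
    moreover have "Poly_Mapping.keys m \<notin> bc_complex G L" if m: "m \<in> Poly_Mapping.keys (p - p')" for m
    proof -
      have "Poly_Mapping.lookup p m - Poly_Mapping.lookup p' m \<noteq> 0"
        using m by (metis in_keys_iff lookup_minus)
      hence "m \<notin> M" "Poly_Mapping.lookup p m \<noteq> 0" by (auto simp: look split: if_splits)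
      moreover from this have "monomial_degree m = d"
        using p(2) unfolding homogeneous_def monomial_degree_def by (metis in_keys_iff)
      ultimately show ?thesis by (simp add: M_iff)
    qed
    ultimately have "p - p' \<in> ?I" unfolding I_eq by blast
    hence "y = ?h p'" using h_eq[OF p(1) p'c] y by simp
    thus "y \<in> ?h ` ?span M" using p'M by blast
  qed
  have "inj_on ?h (?span M)"
    by (rule inj_onI, rule inj) (auto simp: M_iff)
  from h.inj_hom_dimension[OF K one_ne this dimension_monomial_span[OF finM M_sub]]
  have dim: "ring.dimension (bc_ring G L) (card M)
      (bc_scalars G L :: (('e \<Rightarrow>\<^sub>0 nat) \<Rightarrow>\<^sub>0 'k) set set) (bc_graded_part G L d)"
    unfolding hK span .
  \<comment> \<open>Over a subfield the dimension is unique, which resolves the definite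
    description.\<close>
  have "subfield (bc_scalars G L) (bc_ring G L :: (('e \<Rightarrow>\<^sub>0 nat) \<Rightarrow>\<^sub>0 'k) set ring)"
    using h.img_is_subfield(2)[OF K one_ne] unfolding hK .
  hence "(THE n. ring.dimension (bc_ring G L) n
      (bc_scalars G L :: (('e \<Rightarrow>\<^sub>0 nat) \<Rightarrow>\<^sub>0 'k) set set) (bc_graded_part G L d)) = card M"
    using h.S.dimension_is_inj[OF _ _ dim] dim by (intro the_equality) blast+
  also have "card M = (\<Sum>F\<in>bc_complex G L. card (monomials_on F d))"
    unfolding M_def using finite_bc_complex[OF G(1)] finite_bc_complex_member[OF G(1)]
    by (intro card_UN_disjoint) (simp_all add: finite_monomials_on, auto simp: monomials_on_def)
  finally show ?thesis .
qed

text \<open>A face \<open>F\<close> contributes \<open>S ^ card F\<close>. Multiplying by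
  \<open>(1 - fps_X) ^ graph_rank G\<close> clears its denominator and gives the term of
  \<open>F\<close> in the h-polynomial.\<close>

lemma bc_hilbert_series_eq:
  fixes G :: "('v, 'e) mgraph"
  assumes G: "multigraph G" "connected_graph G" "loopless G" and L: "linear_order_on (edges G) L"
  shows "bc_hilbert_series TYPE('k::field) G L =
    fps_of_poly (h_polynomial G L) / (1 - fps_X) ^ graph_rank G"
proof -
  let ?r = "graph_rank G" and ?D = "1 - fps_X :: rat fps"
  have D0: "?D \<noteq> 0" by (metis eq_iff_diff_eq_0 fps_X_neq_one)
  define S :: "rat fps" where "S = fps_X / ?D"
  \<comment> \<open>The quotient is exact because \<open>1 - fps_X\<close> is a unit among formal
    power series.\<close>
  have SD: "S * ?D = fps_X"
  proof -
    have "?D dvd fps_X" by (rule unit_imp_dvd) simp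
    thus ?thesis by (simp add: S_def)
  qed
  have "bc_hilbert_series TYPE('k) G L =
      (\<Sum>F\<in>bc_complex G L. Abs_fps (\<lambda>d. of_nat (card (monomials_on F d))))"
    by (rule fps_ext)
       (simp add: bc_hilbert_series_def bc_graded_part_dimension[OF G(1,3) L] fps_sum_nth)
  also have "\<dots> = (\<Sum>F\<in>bc_complex G L. S ^ card F)"
    using finite_bc_complex_member[OF G(1)]
    by (intro sum.cong) (auto simp: monomials_on_generating_function S_def)
  finally have series: "bc_hilbert_series TYPE('k) G L = (\<Sum>F\<in>bc_complex G L. S ^ card F)" .
  have X: "fps_of_poly [:0, 1:] = (fps_X :: rat fps)"
    by (rule fps_of_poly_fps_X)
  have "fps_of_poly (h_polynomial G L) =
      (\<Sum>F\<in>bc_complex G L. fps_X ^ card F * ?D ^ (?r - card F))"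
    unfolding h_polynomial_eq_sum_faces[OF G L]
    by (simp add: fps_of_poly_sum fps_of_poly_mult fps_of_poly_power fps_of_poly_diff X)
  also have "\<dots> = (\<Sum>F\<in>bc_complex G L. S ^ card F * ?D ^ ?r)"
  proof (rule sum.cong[OF refl])
    fix F assume "F \<in> bc_complex G L"
    then obtain k where k: "?r = card F + k"
      using face_num_components(1)[OF G L] le_Suc_ex by blast
    have "fps_X ^ card F * ?D ^ k = (S * ?D) ^ card F * ?D ^ k" by (simp only: SD)
    also have "\<dots> = S ^ card F * ?D ^ (card F + k)"
      by (simp only: power_mult_distrib power_add mult.assoc)
    finally show "fps_X ^ card F * ?D ^ (?r - card F) = S ^ card F * ?D ^ ?r" by (simp add: k)
  qed
  also have "\<dots> = bc_hilbert_series TYPE('k) G L * ?D ^ ?r"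
    by (simp add: series sum_distrib_right)
  finally show ?thesis using D0 by simp
qed

theorem theorem5p1:
  fixes G :: "('v, 'e) mgraph" and L :: "'e rel"
  assumes "multigraph G" and "connected_graph G" and "loopless G"
    and "linear_order_on (edges G) L"
  defines "r \<equiv> graph_rank G"
    and "z \<equiv> to_fract [:0, 1:] :: rat poly fract"
  defines "q \<equiv> (z - 1) / z"
  shows "to_fract (h_polynomial G L)
           = (- z) ^ r * (eval_txy (negami_polynomial G) q (- 1) 1 / q)
       \<and> bc_hilbert_series TYPE('k::field) G L
           = fps_of_poly (h_polynomial G L) / (1 - fps_X) ^ r"
proof
  show "to_fract (h_polynomial G L)
      = (- z) ^ r * (eval_txy (negami_polynomial G) q (- 1) 1 / q)"
    unfolding r_def by (rule h_polynomial_negami[OF assms(1-4)]) (simp_all add: z_def q_def)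
  show "bc_hilbert_series TYPE('k) G L = fps_of_poly (h_polynomial G L) / (1 - fps_X) ^ r"
    unfolding r_def by (rule bc_hilbert_series_eq[OF assms(1-4)])
qed

end
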